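(* Let $n\ge 3$, let $a_1=0,a_2,\ldots,a_n$ be distinct points of $\mathbb{CP}^1$, and put $M=\mathbb{CP}^1\setminus\{a_1=0,a_2,\ldots,a_n\}$. Let $f:\mathbb{H}\to M$ be a universal (holomorphic) covering map with $f(\infty)=0$ having the expansion $f(\tau)=\sum_{m=1}^{\infty}c_m q^m$, where $q=\exp\{2\pi i\tau/\kappa\}$, $\tau\in\mathbb{H}$, and $\kappa$ is a real constant. Let $q(f)=\sum_{m=1}^\infty b_m f^m$ be the inverse series around $f=0$, so $b_1=1/c_1$. Then for $p\in M$ near $0$ the Kobayashi-Royden metric of $M$ at $p$ in the direction $v\in T_pM$ has the asymptotic expansion $$\chi_M(p;v)=\frac{1}{|p|\,\bigl|\log|b_1p|\bigr|}\cdot\left|1+\sum_{m=1}^{\infty}\left(\sum_{k=1}^{m}\frac{l_k\,C_{m-k}(p)\,p^k}{(k-1)!\,(m-k)!}+\frac{C_m(p)}{m!}\right)\right|\cdot\|v\|,$$ where $C_0(p)=1$ and, for $m\ge 1$, $$C_m(p)=\sum_{k=1}^{m}\frac{(-1)^k k!}{\log^k|b_1p|}\,B_{m,k}\bigl(\operatorname{Re}(l_1p),\ldots,\operatorname{Re}(l_{m-k+1}p^{m-k+1})\bigr),$$ $$l_m=\sum_{k=1}^{m}\frac{(-1)^{k-1}(k-1)!}{b_1^k}\,B_{m,k}\bigl(1!\,b_2,\,2!\,b_3,\ldots,(m-k+1)!\,b_{m-k+2}\bigr).$$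
   Context: $\mathbb{H}$ is the upper half plane and $\mathbb{D}$ is the unit disk in $\mathbb{C}$. The condition $f(\infty)=0$ refers to the cusp $\tau=i\infty$, i.e. $q=0$. The tangent vector $v$ is identified with a complex number via the affine coordinate of $\mathbb{C}$ near $0$, and $\|v\|$ is its absolute value. Kobayashi-Royden metric: for a complex manifold $N$, $z\in N$, $v\in T_zN$, $$\chi_N(z;v)=\inf\{1/\alpha:\ \alpha>0,\ g:\mathbb{D}\to N \text{ holomorphic},\ g(0)=z,\ g'(0)=\alpha v\}.$$ Exponential Bell polynomials: $$B_{n,k}(t_1,\ldots,t_{n-k+1})=\sum\frac{n!\,t_1^{r_1}\cdots t_{n-k+1}^{r_{n-k+1}}}{r_1!\cdots r_{n-k+1}!\,(1!)^{r_1}\cdots((n-k+1)!)^{r_{n-k+1}}},$$ the sum being over all integers $r_1,\ldots,r_{n-k+1}\ge0$ with $r_1+r_2+\cdots+r_{n-k+1}=k$ and $r_1+2r_2+\cdots+(n-k+1)r_{n-k+1}=n$.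
   Formalization: The formula for χ_M(p;v) is proved with an additional factor 1/2 on the right-hand side: with the stated definition of χ_N via the unit disk, χ_ℍ(τ;v)=‖v‖/(2 Im τ), so the printed right-hand side equals 2χ_M(p;v). *)

theory Defs
  imports "HOL-Complex_Analysis.Complex_Analysis"
begin

section \<open>The complex projective line\<close>

datatype cp1 = Fin complex | Infty

text \<open>
  The two standard charts of the Riemann sphere, as parametrizations \<open>Fin\<close> and
  \<open>at_Infty\<close> by the complex plane and, in the other direction, as coordinate functions
  \<open>coord0\<close> (off \<open>Infty\<close>) and \<open>coord1\<close> (off \<open>Fin 0\<close>). The topology is the one glued from
  these charts. The values \<open>coord0 Infty\<close> and \<open>coord1 (Fin 0)\<close> are junk.
\<close>

definition at_Infty :: "complex \<Rightarrow> cp1" where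
  "at_Infty w = (if w = 0 then Infty else Fin (1 / w))"

definition coord0 :: "cp1 \<Rightarrow> complex" where
  "coord0 x = (case x of Fin z \<Rightarrow> z | Infty \<Rightarrow> 0)"

definition coord1 :: "cp1 \<Rightarrow> complex" where
  "coord1 x = (case x of Fin z \<Rightarrow> 1 / z | Infty \<Rightarrow> 0)"

instantiation cp1 :: topological_space
begin

definition open_cp1 :: "cp1 set \<Rightarrow> bool" where
  "open_cp1 U \<longleftrightarrow> open (Fin -` U) \<and> open (at_Infty -` U)"

instance
proof
  fix K :: "cp1 set set"
  assume "\<forall>S\<in>K. open S"
  then show "open (\<Union>K)"
    by (auto simp: open_cp1_def vimage_Union)
qed (auto simp: open_cp1_def)

end

definition holomorphic_to_cp1 :: "(complex \<Rightarrow> cp1) \<Rightarrow> complex set \<Rightarrow> bool" where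
  "holomorphic_to_cp1 f S \<longleftrightarrow>
     continuous_on S f \<and>
     (\<lambda>z. coord0 (f z)) holomorphic_on {z \<in> S. f z \<noteq> Infty} \<and>
     (\<lambda>z. coord1 (f z)) holomorphic_on {z \<in> S. f z \<noteq> Fin 0}"

definition upper_half_plane :: "complex set" where
  "upper_half_plane = {\<tau>. Im \<tau> > 0}"

definition holomorphic_universal_covering ::
    "complex set \<Rightarrow> (complex \<Rightarrow> cp1) \<Rightarrow> cp1 set \<Rightarrow> bool" where
  "holomorphic_universal_covering S f N \<longleftrightarrow>
     simply_connected S \<and> covering_space S f N \<and> holomorphic_to_cp1 f S"

section \<open>The Kobayashi--Royden metric\<close>

text \<open>
  For an open subset \<open>N\<close> of the projective line, at the point \<open>Fin p\<close> of \<open>N\<close>; the tangent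
  vector \<open>v\<close> is written in the affine coordinate. The discs are maps from the unit disc, so
  this is \<open>\<bar>v\<bar> / (1 - \<bar>z\<bar>\<^sup>2)\<close> on the unit disc and \<open>\<bar>v\<bar> / (2 Im \<tau>)\<close> on the upper half plane,
  i.e. one half of the hyperbolic metric of curvature \<open>-1\<close>.
\<close>

definition kobayashi_royden :: "cp1 set \<Rightarrow> complex \<Rightarrow> complex \<Rightarrow> real" where
  "kobayashi_royden N p v =
     Inf {1 / \<alpha> | \<alpha>. \<alpha> > 0 \<and>
       (\<exists>g. holomorphic_to_cp1 g (ball 0 1) \<and> g ` ball 0 1 \<subseteq> N \<and> g 0 = Fin p \<and>
            ((\<lambda>z. coord0 (g z)) has_field_derivative of_real \<alpha> * v) (at 0))}"

section \<open>Bell polynomials and the coefficients of the expansion\<close>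

definition bell_exponents :: "nat \<Rightarrow> nat \<Rightarrow> (nat \<Rightarrow> nat) set" where
  "bell_exponents n k =
     {r \<in> {1..n - k + 1} \<rightarrow>\<^sub>E UNIV.
        (\<Sum>i = 1..n - k + 1. r i) = k \<and> (\<Sum>i = 1..n - k + 1. i * r i) = n}"

lemma finite_bell_exponents: "finite (bell_exponents n k)"
proof (rule finite_subset)
  show "bell_exponents n k \<subseteq> {1..n - k + 1} \<rightarrow>\<^sub>E {..k}"
  proof
    fix r assume r: "r \<in> bell_exponents n k"
    have "r i \<le> k" if "i \<in> {1..n - k + 1}" for i
      using member_le_sum[of i "{1..n - k + 1}" r] that r
      by (auto simp: bell_exponents_def)
    with r show "r \<in> {1..n - k + 1} \<rightarrow>\<^sub>E {..k}"
      by (auto simp: bell_exponents_def PiE_iff)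
  qed
qed (auto intro: finite_PiE)

text \<open>Meaningful for \<open>1 \<le> k \<le> n\<close>; the arguments are \<open>t 1, \<dots>, t (n - k + 1)\<close>.\<close>

definition bell :: "nat \<Rightarrow> nat \<Rightarrow> (nat \<Rightarrow> 'a::field_char_0) \<Rightarrow> 'a" where
  "bell n k t =
     (\<Sum>r \<in> bell_exponents n k.
        fact n * (\<Prod>i = 1..n - k + 1. t i ^ r i) /
        ((\<Prod>i = 1..n - k + 1. fact (r i)) * (\<Prod>i = 1..n - k + 1. fact i ^ r i)))"

text \<open>In the following, \<open>b\<close> is the inverse series \<open>q(f)\<close>, with coefficients \<open>b $ m\<close>.\<close>

definition l_coeff :: "complex fps \<Rightarrow> nat \<Rightarrow> complex" where
  "l_coeff b m =
     (\<Sum>k = 1..m. (-1) ^ (k - 1) * fact (k - 1) / (b $ 1) ^ k *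
        bell m k (\<lambda>j. fact j * b $ (j + 1)))"

definition C_coeff :: "complex fps \<Rightarrow> nat \<Rightarrow> complex \<Rightarrow> real" where
  "C_coeff b m p =
     (if m = 0 then 1
      else \<Sum>k = 1..m. (-1) ^ k * fact k / ln (norm (b $ 1 * p)) ^ k *
             bell m k (\<lambda>j. Re (l_coeff b j * p ^ j)))"

definition expansion_term :: "complex fps \<Rightarrow> complex \<Rightarrow> nat \<Rightarrow> complex" where
  "expansion_term b p m =
     (\<Sum>k = 1..m. l_coeff b k * of_real (C_coeff b (m - k) p) * p ^ k /
        (fact (k - 1) * fact (m - k)))
     + of_real (C_coeff b m p) / fact m"

end

theory Submission
  imports Defs
begin

text \<open>
  Near the puncture \<open>0\<close> the variable \<open>q\<close> is a coordinate, and everything is computed from the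
  inverse \<open>Q\<close> of \<open>F(q) = \<Sum> c\<^sub>m q\<^sup>m\<close>, whose Taylor series is \<open>b\<close>.

  By Schwarz--Pick and lifting of discs, the infimum defining the Kobayashi--Royden metric at
  \<open>p = f(\<tau>)\<close> is attained, for \<open>v \<noteq> 0\<close>, by \<open>f\<close> composed with a
  biholomorphism from the disc to the half plane that sends \<open>0\<close> to \<open>\<tau>\<close>, so the metric is \<open>\<parallel>v\<parallel> / (2 Im \<tau> \<bar>f'(\<tau>)\<bar>)\<close>
  (\<open>kobayashi_royden_eq_covering\<close>). As \<open>0\<close> is not in \<open>M\<close>, the chart \<open>1/z\<close>
  embeds \<open>M\<close> into the plane, and the lifting is one of complex-valued functions.
  For \<open>p\<close> near \<open>0\<close> one may choose \<open>\<tau>\<close> with \<open>q(\<tau>) = Q(p)\<close>. Then \<open>Im \<tau>\<close> is a multiple of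
  \<open>log \<bar>Q(p)\<bar>\<close>, and since \<open>F'(Q(p)) Q'(p) = 1\<close> the metric becomes
  \<open>\<parallel>v\<parallel> \<bar>Q'(p)\<bar> / (2 \<bar>Q(p)\<bar> \<bar>log \<bar>Q(p)\<bar>\<bar>)\<close> (\<open>kobayashi_royden_near_cusp\<close>).

  It remains to expand \<open>(p Q'/Q) \<cdot> (L / log \<bar>Q\<bar>)\<close> with \<open>L = log \<bar>b\<^sub>1 p\<bar>\<close>. Write
  \<open>Q = b\<^sub>1 p exp A\<close>. By Faa di Bruno's formula (\<open>compose_nth_eq_bell\<close>) applied to the logarithm,
  \<open>A(p) = \<Sum> l\<^sub>m p\<^sup>m / m!\<close>. Hence \<open>p Q'/Q = 1 + p A'(p) = 1 + \<Sum> l\<^sub>k p\<^sup>k / (k-1)!\<close>, while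
  \<open>L / log \<bar>Q\<bar> = 1 / (1 + Re A(p) / L)\<close>. Faa di Bruno's formula, now for \<open>1 / (1 + x / L)\<close>
  composed with \<open>\<Sum> Re (l\<^sub>m p\<^sup>m) t\<^sup>m / m!\<close>, expands the last factor as \<open>\<Sum> C\<^sub>m(p) t\<^sup>m / m!\<close>
  at \<open>t = 1\<close>. The Cauchy product of the two series is the stated one.

  Both series are series in an auxiliary variable \<open>t\<close> for fixed \<open>p\<close>, since the \<open>C\<^sub>m(p)\<close> are not
  monomials in \<open>p\<close>. They converge at \<open>t = 1\<close> because for small \<open>p\<close> the functions are holomorphic
  on \<open>\<bar>t\<bar> < 2\<close>: there \<open>\<Sum> Re (l\<^sub>m p\<^sup>m) t\<^sup>m / m!\<close> stays bounded while \<open>\<bar>L\<bar>\<close> tends to infinity,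
  so \<open>1 + x / L\<close> has no zero (\<open>eventually_expansion_sum\<close>).
\<close>

unbundle no vec_syntax

section \<open>Bell polynomials and composition of power series\<close>

definition weighted_exponents :: "nat \<Rightarrow> nat \<Rightarrow> nat \<Rightarrow> (nat \<Rightarrow> nat) set" where
  "weighted_exponents N k n =
     {r \<in> {1..N} \<rightarrow>\<^sub>E UNIV. (\<Sum>i = 1..N. r i) = k \<and> (\<Sum>i = 1..N. i * r i) = n}"

lemma finite_weighted_exponents: "finite (weighted_exponents N k n)"
proof (rule finite_subset)
  show "weighted_exponents N k n \<subseteq> {1..N} \<rightarrow>\<^sub>E {..k}"
  proof
    fix r assume r: "r \<in> weighted_exponents N k n"
    have "r i \<le> k" if "i \<in> {1..N}" for i
      using member_le_sum[of i "{1..N}" r] that r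
      by (auto simp: weighted_exponents_def)
    with r show "r \<in> {1..N} \<rightarrow>\<^sub>E {..k}"
      by (auto simp: weighted_exponents_def PiE_iff)
  qed
qed (auto intro: finite_PiE)

text \<open>
  The exponent of the last variable is split off: \<open>j = r (N + 1)\<close>, and the remaining exponents
  have sum \<open>k - j\<close> and weighted sum \<open>n - j (N + 1)\<close>. Deleting that exponent means resetting it to
  \<open>undefined\<close>, as the exponent functions are extensional.
\<close>

lemma sum_weighted_exponents_Suc:
  fixes x :: "nat \<Rightarrow> 'a::field_char_0"
  shows "(\<Sum>r\<in>weighted_exponents (Suc N) k n. \<Prod>i = 1..Suc N. x i ^ r i / fact (r i)) =
    (\<Sum>j\<in>{j. j \<le> k \<and> j * Suc N \<le> n}. x (Suc N) ^ j / fact j *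
       (\<Sum>r\<in>weighted_exponents N (k - j) (n - j * Suc N). \<Prod>i = 1..N. x i ^ r i / fact (r i)))"
  (is "?L = ?R")
proof -
  let ?J = "{j. j \<le> k \<and> j * Suc N \<le> n}"
  let ?g = "\<lambda>r. \<Prod>i = 1..N. x i ^ r i / fact (r i)"
  have upd1: "(\<Sum>i = 1..N. (r(Suc N := j)) i) = (\<Sum>i = 1..N. r i)"
     and upd2: "(\<Sum>i = 1..N. i * (r(Suc N := j)) i) = (\<Sum>i = 1..N. i * r i)"
     and upd3: "?g (r(Suc N := j)) = ?g r" for r :: "nat \<Rightarrow> nat" and j
    by (auto intro!: sum.cong prod.cong)
  note upd = upd1[unfolded One_nat_def] upd2[unfolded One_nat_def] upd3[unfolded One_nat_def]
  have "?R = (\<Sum>j\<in>?J. \<Sum>r\<in>weighted_exponents N (k - j) (n - j * Suc N).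
                x (Suc N) ^ j / fact j * ?g r)"
    by (simp add: sum_distrib_left)
  also have "\<dots> = (\<Sum>(j, r)\<in>(SIGMA j:?J. weighted_exponents N (k - j) (n - j * Suc N)).
                x (Suc N) ^ j / fact j * ?g r)"
    by (rule sum.Sigma) (auto intro: finite_weighted_exponents)
  also have "\<dots> = ?L"
  proof (rule sum.reindex_bij_witness
      [where i = "\<lambda>r. (r (Suc N), r(Suc N := undefined))" and j = "\<lambda>(j, r). r(Suc N := j)"], goal_cases)
    case (1 a)
    then show ?case
      by (auto simp: weighted_exponents_def PiE_iff extensional_def fun_eq_iff)
  next
    case (2 a)
    then show ?case
      unfolding weighted_exponents_def mem_Collect_eq PiE_iff
      by (auto simp: upd extensional_def)
  next
    case (3 b)
    then show ?case by auto
  next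
    case (4 b)
    then show ?case
      by (auto simp: weighted_exponents_def PiE_iff extensional_def upd[simplified fun_upd_def] algebra_simps)
  next
    case (5 a)
    then show ?case
      by (auto simp: upd3 simp del: fun_upd_apply) simp
  qed
  finally show ?thesis by simp
qed

lemma weighted_exponents_0:
  "weighted_exponents 0 k n = (if k = 0 \<and> n = 0 then {\<lambda>_. undefined} else {})"
  by (auto simp: weighted_exponents_def)

text \<open>
  The multinomial theorem for powers of a polynomial without constant term, in the normalization
  in which every factorial sits under its own variable. Induction on the number of terms
  then turns the binomial theorem into \<open>sum_weighted_exponents_Suc\<close>.
\<close>

lemma multinomial_power_nth:
  fixes x :: "nat \<Rightarrow> 'a::field_char_0"
  shows "((\<Sum>i = 1..N. fps_const (x i) * fps_X ^ i) ^ k) $ n =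
    fact k * (\<Sum>r\<in>weighted_exponents N k n. \<Prod>i = 1..N. x i ^ r i / fact (r i))"
proof (induction N arbitrary: k n)
  case 0
  show ?case by (cases k) (auto simp: weighted_exponents_0)
next
  case (Suc N)
  let ?P = "\<Sum>i = 1..N. fps_const (x i) * fps_X ^ i"
  let ?S = "\<lambda>N k n. \<Sum>r\<in>weighted_exponents N k n. \<Prod>i = 1..N. x i ^ r i / fact (r i)"
  have term_nth: "(of_nat (k choose j) * (fps_const (x (Suc N)) * fps_X ^ Suc N) ^ j * ?P ^ (k - j)) $ n
      = (if j * Suc N \<le> n then fact k * (x (Suc N) ^ j / fact j * ?S N (k - j) (n - j * Suc N)) else 0)"
    if "j \<le> k" for j
  proof -
    have "of_nat (k choose j) * (fps_const (x (Suc N)) * fps_X ^ Suc N) ^ j * ?P ^ (k - j)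
        = of_nat (k choose j) * (fps_const (x (Suc N)) ^ j * (fps_X ^ (j * Suc N) * ?P ^ (k - j)))"
      by (simp only: power_mult_distrib mult.assoc mult.commute[of j] power_mult)
    also have "\<dots> = fps_const (of_nat (k choose j) * x (Suc N) ^ j) * (fps_X ^ (j * Suc N) * ?P ^ (k - j))"
      by (simp only: fps_of_nat[symmetric] fps_const_power fps_const_mult[symmetric] mult.assoc)
    finally have expand: "of_nat (k choose j) * (fps_const (x (Suc N)) * fps_X ^ Suc N) ^ j * ?P ^ (k - j)
        = fps_const (of_nat (k choose j) * x (Suc N) ^ j) * (fps_X ^ (j * Suc N) * ?P ^ (k - j))" .
    show ?thesis
      unfolding expand fps_mult_left_const_nth fps_X_power_mult_nth Suc.IH
      using that by (simp add: binomial_fact del: One_nat_def mult_Suc_right)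
  qed
  have "(\<Sum>i = 1..Suc N. fps_const (x i) * fps_X ^ i) ^ k
      = (\<Sum>j\<le>k. of_nat (k choose j) * (fps_const (x (Suc N)) * fps_X ^ Suc N) ^ j * ?P ^ (k - j))"
    unfolding binomial_ring[symmetric] by (simp add: add.commute)
  then have "((\<Sum>i = 1..Suc N. fps_const (x i) * fps_X ^ i) ^ k) $ n =
     (\<Sum>j\<le>k. if j * Suc N \<le> n then fact k * (x (Suc N) ^ j / fact j * ?S N (k - j) (n - j * Suc N)) else 0)"
    by (simp only: fps_sum_nth) (rule sum.cong[OF refl], rule term_nth, simp)
  also have "\<dots> = (\<Sum>j\<in>{j. j \<le> k \<and> j * Suc N \<le> n}.
       fact k * (x (Suc N) ^ j / fact j * ?S N (k - j) (n - j * Suc N)))"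
    by (subst sum.inter_filter[symmetric]) (auto intro!: sum.cong)
  also have "\<dots> = fact k * ?S (Suc N) k n"
    unfolding sum_weighted_exponents_Suc by (simp add: sum_distrib_left)
  finally show ?case .
qed

text \<open>
  In \<open>T\<^sup>k\<close> each of the \<open>k\<close> factors contributes degree at least \<open>1\<close>, so a coefficient of \<open>T\<close> beyond
  \<open>n - k + 1\<close> cannot reach degree \<open>n\<close>. Formally, the truncation \<open>P\<close> satisfies
  \<open>T = X T'\<close>, \<open>P = X P'\<close>, and \<open>T' - P'\<close>, hence also \<open>T'\<^sup>k - P'\<^sup>k\<close>, is divisible by \<open>X\<^bsup>n-k+1\<^esup>\<close>;
  the missing factor \<open>X\<^sup>k\<close> comes back when passing to \<open>T\<^sup>k - P\<^sup>k\<close>.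
\<close>

lemma power_nth_truncate:
  fixes T :: "'a::comm_ring_1 fps"
  assumes "T $ 0 = 0" "1 \<le> k" "k \<le> n"
  shows "(T ^ k) $ n = ((\<Sum>i = 1..n - k + 1. fps_const (T $ i) * fps_X ^ i) ^ k) $ n"
proof -
  let ?N = "n - k + 1"
  let ?P = "\<Sum>i = 1..?N. fps_const (T $ i) * fps_X ^ i"
  have P_nth: "?P $ m = (if 1 \<le> m \<and> m \<le> ?N then T $ m else 0)" for m
  proof -
    have "?P $ m = (\<Sum>i = 1..?N. if i = m then T $ m else 0)"
      unfolding fps_sum_nth by (intro sum.cong) auto
    then show ?thesis by simp
  qed
  define T' where "T' = fps_shift 1 T"
  define P' where "P' = fps_shift 1 ?P"
  have T: "T = fps_X * T'"
    unfolding T'_def using assms(1) by (intro fps_ext) auto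
  have P: "?P = fps_X * P'"
    unfolding P'_def by (intro fps_ext) (auto simp: P_nth simp del: One_nat_def)
  have "fps_X ^ (n - k + 1) dvd T' - P'"
  proof -
    have "T' - P' = fps_X ^ ?N * fps_shift ?N (T' - P')"
      by (intro fps_ext) (auto simp: fps_X_power_mult_nth T'_def P'_def P_nth simp del: One_nat_def)
    then show ?thesis by (rule dvdI)
  qed
  moreover have "T' - P' dvd T' ^ k - P' ^ k"
    by (metis dvd_triv_left power_diff_sumr2)
  ultimately have "fps_X ^ ?N dvd T' ^ k - P' ^ k"
    by (rule dvd_trans)
  then obtain R where R: "T' ^ k - P' ^ k = fps_X ^ ?N * R" by (elim dvdE)
  have "T ^ k - ?P ^ k = fps_X ^ k * (T' ^ k - P' ^ k)"
    unfolding P by (subst T) (simp add: power_mult_distrib algebra_simps)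
  also have "\<dots> = fps_X ^ (n + 1) * R"
    unfolding R using assms(2,3) by (simp add: algebra_simps flip: power_add mult.assoc)
  finally have "(T ^ k - ?P ^ k) $ n = 0"
    by (simp only: fps_X_power_mult_nth) simp
  then show ?thesis by simp
qed

lemma power_nth_eq_bell:
  fixes T :: "'a::field_char_0 fps"
  assumes "T $ 0 = 0" "1 \<le> k" "k \<le> n"
  shows "(T ^ k) $ n = fact k / fact n * bell n k (\<lambda>j. fact j * T $ j)"
proof -
  have "fact k * (\<Sum>r\<in>bell_exponents n k. \<Prod>i = 1..n - k + 1. (T $ i) ^ r i / fact (r i))
      = fact k / fact n * bell n k (\<lambda>j. fact j * T $ j)"
    unfolding bell_def sum_distrib_left
    by (intro sum.cong refl)
       (simp add: power_mult_distrib prod.distrib prod_dividef del: prod.cl_ivl_Suc One_nat_def)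
  then show ?thesis
    unfolding power_nth_truncate[OF assms] multinomial_power_nth
      bell_exponents_def weighted_exponents_def .
qed

text \<open>
  Faa di Bruno's formula for formal power series. With \<open>T 0 = 0\<close> only the powers \<open>T\<^sup>k\<close> with
  \<open>1 \<le> k \<le> n\<close> reach degree \<open>n \<ge> 1\<close>, and each coefficient of such a power is a Bell polynomial.
\<close>

lemma compose_nth_eq_bell:
  fixes G T :: "'a::field_char_0 fps"
  assumes "T $ 0 = 0" "1 \<le> n"
  shows "(G oo T) $ n = (\<Sum>k = 1..n. fact k * G $ k * bell n k (\<lambda>j. fact j * T $ j)) / fact n"
proof -
  have "(G oo T) $ n = (\<Sum>k = 1..n. G $ k * (T ^ k) $ n)"
    using assms by (simp add: fps_compose_nth sum.atLeast_Suc_atMost)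
  also have "\<dots> = (\<Sum>k = 1..n. fact k * G $ k * bell n k (\<lambda>j. fact j * T $ j) / fact n)"
    using assms by (intro sum.cong) (auto simp: power_nth_eq_bell)
  finally show ?thesis by (simp add: sum_divide_distrib)
qed

lemma bell_scale: "bell n k (\<lambda>j. s * t j) = s ^ k * bell n k t"
  unfolding bell_def sum_distrib_left
proof (rule sum.cong)
  fix r assume r: "r \<in> bell_exponents n k"
  have "(\<Prod>i = 1..n - k + 1. (s * t i) ^ r i) = s ^ k * (\<Prod>i = 1..n - k + 1. t i ^ r i)"
    using r by (simp add: power_mult_distrib prod.distrib bell_exponents_def flip: power_sum)
  then show "fact n * (\<Prod>i = 1..n - k + 1. (s * t i) ^ r i) /
        ((\<Prod>i = 1..n - k + 1. fact (r i)) * (\<Prod>i = 1..n - k + 1. fact i ^ r i)) =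
     s ^ k * (fact n * (\<Prod>i = 1..n - k + 1. t i ^ r i) /
        ((\<Prod>i = 1..n - k + 1. fact (r i)) * (\<Prod>i = 1..n - k + 1. fact i ^ r i)))"
    by simp
qed simp

lemma of_real_bell: "(of_real (bell n k t) :: complex) = bell n k (\<lambda>j. of_real (t j))"
  unfolding bell_def by simp

text \<open>
  The argument \<open>t 0\<close> never enters a Bell polynomial.
\<close>

lemma bell_cong:
  assumes "\<And>j. 1 \<le> j \<Longrightarrow> t j = t' j"
  shows "bell n k t = bell n k t'"
  unfolding bell_def using assms by (intro sum.cong arg_cong2[of _ _ _ _ "(/)"] arg_cong2[of _ _ _ _ "(*)"]
      prod.cong refl) simp_all

section \<open>The expansion as a product of two power series\<close>

text \<open>
  The logarithm of \<open>b / (b\<^sub>1 X)\<close>, by \<open>log_series_eq_ln\<close> below.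
\<close>

definition log_series :: "complex fps \<Rightarrow> complex fps" where
  "log_series b = Abs_fps (\<lambda>m. l_coeff b m / fact m)"

definition unit_part :: "complex fps \<Rightarrow> complex fps" where
  "unit_part b = fps_const (1 / b $ 1) * fps_shift 1 b"

lemma unit_part_mult:
  assumes "b $ 0 = 0" "b $ 1 \<noteq> 0"
  shows "b = fps_const (b $ 1) * fps_X * unit_part b"
proof (rule fps_ext)
  fix n
  show "b $ n = (fps_const (b $ 1) * fps_X * unit_part b) $ n"
    using assms by (cases n) (auto simp: unit_part_def mult.assoc)
qed

text \<open>
  Faa di Bruno's formula for the logarithm; the factor \<open>1 / b\<^sub>1\<close> in each argument of the Bell
  polynomials comes out as \<open>1 / b\<^sub>1\<^sup>k\<close> by homogeneity.
\<close>

lemma log_series_eq_ln: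
  assumes "b $ 1 \<noteq> 0"
  shows "log_series b = fps_ln 1 oo (unit_part b - 1)"
proof (rule fps_ext)
  fix m
  let ?B = "unit_part b - 1"
  have B_nth: "?B $ j = (1 / b $ 1) * b $ (j + 1)" if "j \<ge> 1" for j
    using that by (simp add: unit_part_def)
  have B0: "?B $ 0 = 0" using assms by (simp add: unit_part_def)
  show "log_series b $ m = (fps_ln 1 oo ?B) $ m"
  proof (cases "m = 0")
    case True
    then show ?thesis by (simp add: log_series_def l_coeff_def)
  next
    case False
    have "fact k * fps_ln 1 $ k * bell m k (\<lambda>j. fact j * ?B $ j) =
        (- 1) ^ (k - 1) * fact (k - 1) / (b $ 1) ^ k * bell m k (\<lambda>j. fact j * b $ (j + 1))"
      if "k \<in> {1..m}" for k
    proof -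
      have "bell m k (\<lambda>j. fact j * ?B $ j) = bell m k (\<lambda>j. (1 / b $ 1) * (fact j * b $ (j + 1)))"
        by (rule bell_cong) (simp only: B_nth mult.left_commute)
      also have "\<dots> = (1 / b $ 1) ^ k * bell m k (\<lambda>j. fact j * b $ (j + 1))"
        by (rule bell_scale)
      finally show ?thesis
        using that by (cases k) (auto simp: fps_ln_nth field_simps simp del: of_nat_Suc)
    qed
    then have "(\<Sum>k = 1..m. fact k * fps_ln 1 $ k * bell m k (\<lambda>j. fact j * ?B $ j)) = l_coeff b m"
      unfolding l_coeff_def by (intro sum.cong) auto
    then show ?thesis
      using False by (simp only: compose_nth_eq_bell[OF B0]) (simp add: log_series_def compose_nth_eq_bell[OF B0])
  qed
qed

lemma exp_log_series:
  assumes "b $ 1 \<noteq> 0"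
  shows "fps_exp 1 oo log_series b = unit_part b"
proof -
  let ?B = "unit_part b - 1"
  let ?E = "fps_exp 1 - 1 :: complex fps"
  have B0: "?B $ 0 = 0" using assms by (simp add: unit_part_def)
  have "?E oo fps_ln 1 = fps_X"
    using fps_inv_right[of ?E] by (simp add: fps_ln_fps_exp_inv)
  then have "?E oo (fps_ln 1 oo ?B) = fps_X oo ?B"
    by (simp only: fps_compose_assoc[OF B0 fps_ln_0])
  then have "(fps_exp 1 oo log_series b) - 1 = ?B"
    using B0 by (simp add: log_series_eq_ln[OF assms] fps_compose_sub_distrib)
  then show ?thesis by simp
qed

lemma log_series_0: "log_series b $ 0 = 0"
  by (simp add: log_series_def l_coeff_def)

text \<open>
  The logarithmic derivative of \<open>b = b\<^sub>1 X exp A\<close>, where \<open>A\<close> is the logarithm series.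
\<close>

lemma deriv_log_series:
  assumes "b $ 0 = 0" "b $ 1 \<noteq> 0"
  shows "fps_X * fps_deriv b = b * (1 + fps_X * fps_deriv (log_series b))"
proof -
  let ?u = "unit_part b"
  have u': "fps_deriv ?u = ?u * fps_deriv (log_series b)"
    using fps_compose_deriv[OF log_series_0, of "fps_exp 1" b]
    by (simp add: exp_log_series[OF assms(2)])
  have "fps_X * fps_deriv b = fps_X * (fps_const (b $ 1) * (?u + fps_X * fps_deriv ?u))"
    by (subst unit_part_mult[OF assms]) (simp add: algebra_simps)
  also have "\<dots> = (fps_const (b $ 1) * fps_X * ?u) * (1 + fps_X * fps_deriv (log_series b))"
    by (simp add: u' algebra_simps)
  also have "\<dots> = b * (1 + fps_X * fps_deriv (log_series b))"
    by (simp only: unit_part_mult[OF assms, symmetric])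
  finally show ?thesis .
qed

lemma conv_radius_unit_part: "b $ 1 \<noteq> 0 \<Longrightarrow> fps_conv_radius (unit_part b) = fps_conv_radius b"
  by (simp add: unit_part_def fps_conv_radius_cmult_left)

text \<open>
  Composition of convergent series: \<open>log_series_eq_ln\<close> presents the series as such a composition.
\<close>

lemma conv_radius_log_series:
  assumes "b $ 1 \<noteq> 0" "fps_conv_radius b > 0"
  shows "fps_conv_radius (log_series b) > 0"
proof -
  have "eval_fps (fps_ln (1::complex)) has_fps_expansion fps_ln 1"
    by (rule eval_fps_has_fps_expansion) simp
  moreover have "fps_conv_radius (unit_part b - 1) > 0"
    using fps_conv_radius_diff[of "unit_part b" 1] assms by (simp add: conv_radius_unit_part)
  then have "eval_fps (unit_part b - 1) has_fps_expansion (unit_part b - 1)"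
    by (rule eval_fps_has_fps_expansion)
  moreover have "(unit_part b - 1) $ 0 = 0" using assms by (simp add: unit_part_def)
  ultimately have "(eval_fps (fps_ln 1) \<circ> eval_fps (unit_part b - 1)) has_fps_expansion
      (fps_ln 1 oo (unit_part b - 1))"
    by (rule has_fps_expansion_compose)
  then show ?thesis
    using assms by (simp add: log_series_eq_ln has_fps_expansion_def)
qed

lemma eventually_eval_fps_eq_exp_log_series:
  assumes "b $ 0 = 0" "b $ 1 \<noteq> 0" "fps_conv_radius b > 0"
  shows "\<forall>\<^sub>F p in nhds 0. eval_fps b p = b $ 1 * p * exp (eval_fps (log_series b) p)"
proof -
  have "exp has_fps_expansion (fps_exp 1 :: complex fps)"
    by (rule has_fps_expansion_exp1)
  moreover have "eval_fps (log_series b) has_fps_expansion log_series b"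
    using assms by (intro eval_fps_has_fps_expansion conv_radius_log_series)
  ultimately have "(exp \<circ> eval_fps (log_series b)) has_fps_expansion (fps_exp 1 oo log_series b)"
    by (rule has_fps_expansion_compose) (rule log_series_0)
  then have "(\<lambda>p. exp (eval_fps (log_series b) p)) has_fps_expansion unit_part b"
    by (simp add: o_def exp_log_series[OF assms(2)])
  then have "(\<lambda>p. b $ 1 * p * exp (eval_fps (log_series b) p)) has_fps_expansion
      (fps_const (b $ 1) * fps_X * unit_part b)"
    by (intro fps_expansion_intros)
  then have "(\<lambda>p. b $ 1 * p * exp (eval_fps (log_series b) p)) has_fps_expansion b"
    by (simp only: unit_part_mult[OF assms(1,2), symmetric])
  then show ?thesis by (simp add: has_fps_expansion_def)
qed

lemma eventually_deriv_eq_log_series: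
  assumes "b $ 0 = 0" "b $ 1 \<noteq> 0" "fps_conv_radius b > 0"
  shows "\<forall>\<^sub>F p in nhds 0. p * eval_fps (fps_deriv b) p =
    eval_fps b p * (1 + p * eval_fps (fps_deriv (log_series b)) p)"
proof -
  have b: "eval_fps b has_fps_expansion b" and b': "eval_fps (fps_deriv b) has_fps_expansion fps_deriv b"
    using assms(3) fps_conv_radius_deriv[of b] by (auto intro!: eval_fps_has_fps_expansion)
  have l': "eval_fps (fps_deriv (log_series b)) has_fps_expansion fps_deriv (log_series b)"
    using conv_radius_log_series[OF assms(2,3)] fps_conv_radius_deriv[of "log_series b"]
    by (auto intro!: eval_fps_has_fps_expansion)
  have "(\<lambda>p. p * eval_fps (fps_deriv b) p) has_fps_expansion (fps_X * fps_deriv b)"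
    by (intro fps_expansion_intros b')
  moreover have "(\<lambda>p. eval_fps b p * (1 + p * eval_fps (fps_deriv (log_series b)) p))
      has_fps_expansion (b * (1 + fps_X * fps_deriv (log_series b)))"
    by (intro fps_expansion_intros b l')
  ultimately show ?thesis
    unfolding deriv_log_series[OF assms(1,2)] has_fps_expansion_def
    by (auto elim: eventually_elim2)
qed

text \<open>
  For fixed \<open>p\<close>, the following are series in the auxiliary variable \<open>t\<close> that counts the weight \<open>m\<close>;
  the values of interest are those at \<open>t = 1\<close>. With \<open>A\<close> the logarithm series, the value of this
  one is \<open>Re (A p)\<close>.
\<close>

definition scaled_Re_log_series :: "complex fps \<Rightarrow> complex \<Rightarrow> complex fps" where
  "scaled_Re_log_series b p = Abs_fps (\<lambda>m. of_real (Re (l_coeff b m * p ^ m)) / fact m)"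

text \<open>
  The reciprocal of \<open>1 + U / L\<close>, where \<open>U\<close> is the series above and \<open>L = log \<bar>b\<^sub>1 p\<bar>\<close>.
\<close>

definition reciprocal_series :: "complex fps \<Rightarrow> complex \<Rightarrow> complex fps" where
  "reciprocal_series b p = Abs_fps (\<lambda>m. of_real (C_coeff b m p) / fact m)"

text \<open>
  The value at \<open>t = 1\<close> is \<open>p A'(p)\<close>.
\<close>

definition scaled_deriv_series :: "complex fps \<Rightarrow> complex \<Rightarrow> complex fps" where
  "scaled_deriv_series b p = Abs_fps (\<lambda>m. (fps_X * fps_deriv (log_series b)) $ m * p ^ m)"

text \<open>
  Faa di Bruno's formula for the geometric series \<open>G = 1 / (1 + X / L)\<close> composed with \<open>U\<close>.
\<close>

lemma reciprocal_series_mult: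
  fixes b p
  defines "L \<equiv> complex_of_real (ln (norm (b $ 1 * p)))"
  assumes "L \<noteq> 0"
  shows "(1 + fps_const (1 / L) * scaled_Re_log_series b p) * reciprocal_series b p = 1"
proof -
  let ?U = "scaled_Re_log_series b p"
  define G where "G = Abs_fps (\<lambda>k. (- 1) ^ k / L ^ k)"
  have U0: "?U $ 0 = 0" by (simp add: scaled_Re_log_series_def l_coeff_def)
  have U_nth: "fact j * ?U $ j = of_real (Re (l_coeff b j * p ^ j))" for j
    by (simp only: scaled_Re_log_series_def fps_nth_Abs_fps times_divide_eq_right
        nonzero_mult_div_cancel_left[OF fact_nonzero])
  have V: "reciprocal_series b p = G oo ?U"
  proof (rule fps_ext)
    fix m
    show "reciprocal_series b p $ m = (G oo ?U) $ m"
    proof (cases "m = 0")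
      case True
      then show ?thesis by (simp add: reciprocal_series_def C_coeff_def G_def)
    next
      case False
      have "complex_of_real (C_coeff b m p) =
          (\<Sum>k = 1..m. fact k * G $ k * bell m k (\<lambda>j. fact j * ?U $ j))"
        using False unfolding C_coeff_def U_nth of_real_bell[symmetric]
        by (simp add: G_def L_def mult.commute[of "fact _"] del: times_complex.sel)
      then show ?thesis
        using False compose_nth_eq_bell[OF U0, of m G] by (simp add: reciprocal_series_def)
    qed
  qed
  have "(1 + fps_const (1 / L) * fps_X) * G = 1"
  proof (rule fps_ext)
    fix n
    show "((1 + fps_const (1 / L) * fps_X) * G) $ n = (1 :: complex fps) $ n"
      using assms by (cases n) (auto simp: G_def distrib_right mult.assoc field_simps)
  qed
  then have "((1 + fps_const (1 / L) * fps_X) oo ?U) * (G oo ?U) = 1"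
    by (simp flip: fps_compose_mult_distrib[OF U0])
  then show ?thesis
    using U0 by (simp add: V fps_compose_add_distrib fps_compose_mult_distrib)
qed

text \<open>
  The terms of the expansion are the coefficients of a Cauchy product.
\<close>

lemma expansion_series_eq:
  "Abs_fps (expansion_term b p) = (1 + scaled_deriv_series b p) * reciprocal_series b p"
proof (rule fps_ext)
  fix m
  let ?W = "scaled_deriv_series b p" and ?V = "reciprocal_series b p"
  have W: "?W $ k = l_coeff b k * p ^ k / fact (k - 1)" if "k \<ge> 1" for k
    using that by (cases k) (auto simp: scaled_deriv_series_def log_series_def field_simps simp del: of_nat_Suc)
  have "(?W * ?V) $ m = (\<Sum>k = 0..m. ?W $ k * ?V $ (m - k))"
    by (simp add: fps_mult_nth)
  also have "\<dots> = (\<Sum>k = 1..m. ?W $ k * ?V $ (m - k))"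
    by (simp add: sum.atLeast_Suc_atMost scaled_deriv_series_def)
  also have "\<dots> = (\<Sum>k = 1..m. l_coeff b k * of_real (C_coeff b (m - k) p) * p ^ k /
        (fact (k - 1) * fact (m - k)))"
    by (intro sum.cong) (auto simp: W reciprocal_series_def simp del: One_nat_def)
  finally show "Abs_fps (expansion_term b p) $ m = ((1 + ?W) * ?V) $ m"
    by (simp add: distrib_right expansion_term_def reciprocal_series_def)
qed

lemma scaled_fps:
  fixes D :: "complex fps"
  shows "eval_fps (Abs_fps (\<lambda>m. D $ m * p ^ m)) t = eval_fps D (p * t)"
    and "norm (p * of_real \<rho>) < fps_conv_radius D \<Longrightarrow> fps_conv_radius (Abs_fps (\<lambda>m. D $ m * p ^ m)) \<ge> ereal \<bar>\<rho>\<bar>"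
proof -
  show "eval_fps (Abs_fps (\<lambda>m. D $ m * p ^ m)) t = eval_fps D (p * t)"
    by (simp add: eval_fps_def power_mult_distrib mult.assoc)
  assume "norm (p * of_real \<rho>) < fps_conv_radius D"
  then have "summable (\<lambda>m. D $ m * (p * of_real \<rho>) ^ m)"
    by (rule summable_fps)
  then have "summable (\<lambda>m. (Abs_fps (\<lambda>m. D $ m * p ^ m)) $ m * of_real \<rho> ^ m)"
    by (simp add: power_mult_distrib mult.assoc)
  then have "fps_conv_radius (Abs_fps (\<lambda>m. D $ m * p ^ m)) \<ge> norm (of_real \<rho> :: complex)"
    unfolding fps_conv_radius_def by (rule conv_radius_geI)
  then show "fps_conv_radius (Abs_fps (\<lambda>m. D $ m * p ^ m)) \<ge> ereal \<bar>\<rho>\<bar>" by simp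
qed

text \<open>
  Since \<open>\<bar>Re (l\<^sub>m p\<^sup>m)\<bar> \<le> \<bar>l\<^sub>m\<bar> \<bar>p\<bar>\<^sup>m\<close>, the series is dominated on \<open>\<bar>t\<bar> \<le> 2\<close> by a convergent
  series that does not depend on \<open>p\<close>. The uniform bound is what makes the quotient by
  \<open>log \<bar>b\<^sub>1 p\<bar>\<close> small for small \<open>p\<close>.
\<close>

lemma scaled_Re_log_series_bounds:
  assumes R: "0 < R" "ereal R < fps_conv_radius (log_series b)" and p: "2 * norm p \<le> R"
  shows "fps_conv_radius (scaled_Re_log_series b p) \<ge> 2"
    and "norm t \<le> 2 \<Longrightarrow>
      norm (eval_fps (scaled_Re_log_series b p) t) \<le> (\<Sum>m. norm (log_series b $ m) * R ^ m)"
    and "eval_fps (scaled_Re_log_series b p) 1 = of_real (Re (eval_fps (log_series b) p))"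
proof -
  let ?A = "log_series b" and ?U = "scaled_Re_log_series b p"
  have sumR: "summable (\<lambda>m. norm (?A $ m) * R ^ m)"
    using norm_summable_fps[of "of_real R :: complex" ?A] R
    by (simp add: norm_mult norm_power)
  have U_nth: "?U $ m = of_real (Re (?A $ m * p ^ m))" for m
  proof -
    have "?A $ m * p ^ m = (l_coeff b m * p ^ m) / of_real (fact m)"
      by (simp add: log_series_def)
    then have "Re (?A $ m * p ^ m) = Re (l_coeff b m * p ^ m) / fact m"
      by (simp only: Re_divide_of_real)
    then show ?thesis
      by (simp only: scaled_Re_log_series_def fps_nth_Abs_fps of_real_divide of_real_fact)
  qed
  have bound: "norm (?U $ m * t ^ m) \<le> norm (?A $ m) * R ^ m" if "norm t \<le> 2" for t m
  proof -
    have "norm p * norm t \<le> R"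
      using mult_left_mono[OF that, of "norm p"] p by simp
    then have "norm (?A $ m) * (norm p * norm t) ^ m \<le> norm (?A $ m) * R ^ m"
      by (intro mult_left_mono power_mono) auto
    moreover have "norm (?U $ m * t ^ m) \<le> norm (?A $ m * p ^ m) * norm t ^ m"
      unfolding U_nth norm_mult norm_power norm_of_real
      by (intro mult_right_mono abs_Re_le_cmod[of "?A $ m * p ^ m", unfolded norm_mult norm_power]) simp
    ultimately show ?thesis by (simp add: norm_mult norm_power power_mult_distrib mult.assoc)
  qed
  then have summ: "summable (\<lambda>m. norm (?U $ m * t ^ m))" if "norm t \<le> 2" for t
    using that by (intro summable_comparison_test'[OF sumR, of 0]) auto
  have "fps_conv_radius ?U \<ge> norm (2 :: complex)"
    unfolding fps_conv_radius_def using summable_norm_cancel[OF summ[of 2]]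
    by (intro conv_radius_geI) simp
  then show "fps_conv_radius ?U \<ge> 2" by simp
  show "norm (eval_fps ?U t) \<le> (\<Sum>m. norm (?A $ m) * R ^ m)" if "norm t \<le> 2"
    unfolding eval_fps_def using summable_norm[OF summ[OF that]] suminf_le[OF bound[OF that] summ[OF that] sumR]
    by linarith
  have "norm p < R" using p R(1) by simp
  then have "ereal (norm p) < ereal R" by simp
  also note R(2)
  finally have "ereal (norm p) < fps_conv_radius ?A" .
  then have "(\<lambda>m. ?A $ m * p ^ m) sums eval_fps ?A p" by (rule sums_eval_fps)
  then have "(\<lambda>m. of_real (Re (?A $ m * p ^ m))) sums (of_real (Re (eval_fps ?A p)) :: complex)"
    by (intro sums_of_real sums_Re)
  then show "eval_fps ?U 1 = of_real (Re (eval_fps ?A p))"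
    by (simp add: eval_fps_def U_nth sums_iff)
qed

text \<open>
  The radius \<open>2\<close> only serves to have \<open>t = 1\<close> strictly inside the discs of convergence. On
  \<open>\<bar>t\<bar> < 2\<close> the function \<open>1 + U(t) / L\<close> has no zero as soon as \<open>\<bar>L\<bar>\<close> exceeds the uniform bound
  for \<open>U\<close>, and then its reciprocal is represented there by its power series.
\<close>

lemma eventually_expansion_sum:
  assumes b1: "b $ 1 \<noteq> 0" and rad: "fps_conv_radius b > 0"
  shows "\<forall>\<^sub>F p in at 0. summable (\<lambda>m. expansion_term b p (Suc m)) \<and>
     1 + (\<Sum>m. expansion_term b p (Suc m)) =
       (1 + p * eval_fps (fps_deriv (log_series b)) p) /
       of_real (1 + Re (eval_fps (log_series b) p) / ln (norm (b $ 1 * p)))"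
proof -
  let ?A = "log_series b"
  obtain R where R: "0 < R" "ereal R < fps_conv_radius ?A"
    using conv_radius_log_series[OF assms] ereal_dense2 by (metis ereal_less(2))
  define K where "K = (\<Sum>m. norm (?A $ m) * R ^ m)"
  have "\<forall>\<^sub>F p in at 0. 2 * norm p < R" "\<forall>\<^sub>F p in at 0. norm (b $ 1 * p) < exp (- \<bar>K\<bar> - 1)"
    by (rule order_tendstoD(2)[of _ 0], auto intro!: tendsto_eq_intros simp: R)+
  moreover have "\<forall>\<^sub>F p in at 0. p \<noteq> (0::complex)" by (rule eventually_neq_at_within)
  ultimately show ?thesis
  proof eventually_elim
    case (elim p)
    let ?U = "scaled_Re_log_series b p" and ?V = "reciprocal_series b p"
      and ?W = "scaled_deriv_series b p"
    define L where "L = ln (norm (b $ 1 * p))"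
    have "L < ln (exp (- \<bar>K\<bar> - 1))"
      unfolding L_def using elim b1 by (intro ln_less_cancel_iff[THEN iffD2]) auto
    then have "L < - \<bar>K\<bar> - 1" by simp
    then have L: "\<bar>L\<bar> > \<bar>K\<bar>" "L \<noteq> 0" by linarith+
    define f where "f = 1 + fps_const (1 / complex_of_real L) * ?U"
    note U = scaled_Re_log_series_bounds[OF R less_imp_le[OF elim(1)]]
    have gt1: "ereal (norm (1::complex)) < r" if "r \<ge> 2" for r :: ereal
      using that by (intro less_le_trans[OF _ that]) simp
    have eval_f: "eval_fps f t = 1 + eval_fps ?U t / of_real L" if "norm t < 2" for t
    proof -
      have "ereal (norm t) < fps_conv_radius ?U"
        using that by (intro less_le_trans[OF _ U(1)]) simp
      then show ?thesis
        by (simp add: f_def eval_fps_add eval_fps_mult fps_conv_radius_cmult_left L)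
    qed
    have rad_f: "fps_conv_radius f \<ge> 2"
      using fps_conv_radius_add[of 1 "fps_const (1 / complex_of_real L) * ?U"] U(1) L
      by (simp add: f_def fps_conv_radius_cmult_left)
    have nz: "eval_fps f t \<noteq> 0" if "t \<in> eball 0 2" for t
    proof
      assume 0: "eval_fps f t = 0"
      have t: "norm t < 2" using that by simp
      have "1 + eval_fps ?U t / of_real L = 0" using eval_f[OF t] 0 by simp
      then have "eval_fps ?U t = - of_real L" using L by (simp add: field_simps add_eq_0_iff)
      then have "norm (eval_fps ?U t) = \<bar>L\<bar>" by simp
      moreover have "norm (eval_fps ?U t) \<le> K"
        unfolding K_def using t by (intro U(2)) simp
      ultimately show False using L by linarith
    qed
    have "f * ?V = 1"
      unfolding f_def L_def by (rule reciprocal_series_mult) (use L in \<open>simp add: L_def\<close>)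
    then have V: "?V = inverse f" by (metis fps_inverse_unique)
    have rad_V: "fps_conv_radius ?V \<ge> 2"
      using fps_conv_radius_inverse[of 2 f] nz rad_f by (simp add: V)
    have eval_V: "eval_fps ?V 1 = inverse (1 + of_real (Re (eval_fps ?A p)) / of_real L)"
    proof -
      have "eval_fps ?V 1 = inverse (eval_fps f 1)"
        unfolding V using nz gt1[OF rad_f] by (intro eval_fps_inverse[of 2]) auto
      then show ?thesis by (simp add: eval_f U(3))
    qed
    have "ereal (norm (p * of_real 2)) < ereal R"
      using elim(1) by (simp add: norm_mult mult.commute)
    also have "\<dots> < fps_conv_radius ?A" by (rule R)
    also have "\<dots> \<le> fps_conv_radius (fps_deriv ?A)" by (rule fps_conv_radius_deriv)
    also have "\<dots> \<le> fps_conv_radius (fps_X * fps_deriv ?A)"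
      using fps_conv_radius_mult[of fps_X "fps_deriv ?A"] by simp
    finally have "norm (p * of_real 2) < fps_conv_radius (fps_X * fps_deriv ?A)" .
    then have "fps_conv_radius ?W \<ge> ereal \<bar>2\<bar>"
      unfolding scaled_deriv_series_def by (rule scaled_fps(2))
    then have rad_W: "fps_conv_radius ?W \<ge> 2" by simp
    have eval_W: "eval_fps ?W 1 = p * eval_fps (fps_deriv ?A) p"
    proof -
      have "norm p < R" using elim(1) R(1) by simp
      then have "ereal (norm p) < ereal R" by simp
      also note R(2)
      finally have "ereal (norm p) < fps_conv_radius ?A" .
      then have "ereal (norm p) < fps_conv_radius (fps_deriv ?A)"
        using fps_conv_radius_deriv[of ?A] by (rule less_le_trans)
      then show ?thesis
        unfolding scaled_deriv_series_def scaled_fps(1) by (simp add: eval_fps_mult)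
    qed
    have rad_1W: "fps_conv_radius (1 + ?W) \<ge> 2"
      using fps_conv_radius_add[of 1 ?W] rad_W by simp
    have "ereal (norm (1::complex)) < fps_conv_radius ((1 + ?W) * ?V)"
      using rad_1W rad_V
      by (intro gt1 order_trans[OF _ fps_conv_radius_mult]) simp
    then have "(\<lambda>m. ((1 + ?W) * ?V) $ m * 1 ^ m) sums eval_fps ((1 + ?W) * ?V) 1"
      by (rule sums_eval_fps)
    then have sums: "expansion_term b p sums eval_fps ((1 + ?W) * ?V) 1"
      by (simp flip: expansion_series_eq)
    have eval: "eval_fps ((1 + ?W) * ?V) 1 = (1 + p * eval_fps (fps_deriv ?A) p) /
       of_real (1 + Re (eval_fps ?A p) / L)"
      using rad_1W rad_V rad_W
      by (simp add: eval_fps_mult eval_fps_add gt1[simplified] eval_V eval_W divide_inverse)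
    have "expansion_term b p 0 = 1" by (simp add: expansion_term_def C_coeff_def)
    then have "(\<lambda>m. expansion_term b p (Suc m)) sums (eval_fps ((1 + ?W) * ?V) 1 - 1)"
      using sums by (simp add: sums_Suc_iff)
    then show ?case
      by (simp add: sums_iff eval L_def)
  qed
qed

section \<open>The Kobayashi--Royden metric and universal coverings\<close>

lemma at_Infty_coord1: "x \<noteq> Fin 0 \<Longrightarrow> at_Infty (coord1 x) = x"
  by (cases x) (auto simp: at_Infty_def coord1_def)

lemma coord1_at_Infty: "coord1 (at_Infty w) = w"
  by (auto simp: at_Infty_def coord1_def)

lemma at_Infty_neq_0: "at_Infty w \<noteq> Fin 0"
  by (auto simp: at_Infty_def)

text \<open>
  The chart at infinity identifies the sphere without \<open>0\<close> with the plane. Maps into a set that omits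
  \<open>0\<close> can therefore be treated as complex-valued functions, including at points over infinity.
\<close>

lemma homeomorphism_coord1: "homeomorphism (- {Fin 0}) UNIV coord1 at_Infty"
proof (rule homeomorphismI)
  have "open (coord1 -` V \<inter> - {Fin 0})" if "open V" for V
  proof -
    have "Fin -` (coord1 -` V \<inter> - {Fin 0}) = (\<lambda>z. 1 / z) -` V \<inter> - {0}"
      by (auto simp: coord1_def)
    moreover have "open ((\<lambda>z::complex. 1 / z) -` V \<inter> - {0})"
    proof -
      have "open (- {0} \<inter> (\<lambda>z::complex. 1 / z) -` V)"
        using that by (intro continuous_open_preimage continuous_intros) auto
      then show ?thesis by (simp add: Int_commute)
    qed
    moreover have "at_Infty -` (coord1 -` V \<inter> - {Fin 0}) = V"
      by (auto simp: coord1_at_Infty at_Infty_neq_0)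
    ultimately show ?thesis
      using that by (simp add: open_cp1_def)
  qed
  moreover have "open (- {Fin 0})"
  proof -
    have "Fin -` (- {Fin 0}) = - {0}" "at_Infty -` (- {Fin 0}) = UNIV"
      by (auto simp: at_Infty_neq_0)
    then show ?thesis by (simp add: open_cp1_def open_Compl)
  qed
  ultimately show "continuous_on (- {Fin 0}) coord1"
    by (simp add: continuous_on_open_vimage Int_commute)
  show "continuous_on UNIV at_Infty"
    by (auto simp: continuous_on_open_vimage open_cp1_def)
qed (auto simp: at_Infty_coord1 coord1_at_Infty at_Infty_neq_0 at_Infty_neq_0[symmetric])

lemma covering_space_compose_homeomorphism:
  assumes cov: "covering_space C p S" and hom: "homeomorphism S T h k"
  shows "covering_space C (h \<circ> p) T"
proof
  have pC: "p ` C = S" and contp: "continuous_on C p"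
    using cov by (auto simp: covering_space_def)
  have hS: "h ` S = T" and kT: "k ` T = S" and kh: "\<And>x. x \<in> S \<Longrightarrow> k (h x) = x"
    and hk: "\<And>y. y \<in> T \<Longrightarrow> h (k y) = y" and conth: "continuous_on S h"
    using hom by (auto simp: homeomorphism_def)
  show "continuous_on C (h \<circ> p)"
    using contp conth pC by (intro continuous_on_compose) auto
  show "(h \<circ> p) ` C = T"
    using pC hS by (metis image_comp)
  show "\<exists>U. y \<in> U \<and> openin (top_of_set T) U \<and>
         (\<exists>v. \<Union>v = C \<inter> (h \<circ> p) -` U \<and> (\<forall>u\<in>v. openin (top_of_set C) u) \<and>
              pairwise disjnt v \<and> (\<forall>u\<in>v. \<exists>q. homeomorphism u U (h \<circ> p) q))" if "y \<in> T" for y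
  proof -
    have "k y \<in> S" using that kT by auto
    then obtain U v where U: "k y \<in> U" "openin (top_of_set S) U"
      and v: "\<Union>v = C \<inter> p -` U" "\<forall>u\<in>v. openin (top_of_set C) u" "pairwise disjnt v"
        "\<forall>u\<in>v. \<exists>q. homeomorphism u U p q"
      using cov unfolding covering_space_def by metis
    have US: "U \<subseteq> S" using U(2) by (auto dest: openin_imp_subset)
    have "y \<in> h ` U" using U(1) hk[OF that] by force
    moreover have "openin (top_of_set T) (h ` U)"
      using homeomorphism_imp_open_map[OF hom U(2)] .
    moreover have "C \<inter> (h \<circ> p) -` (h ` U) = C \<inter> p -` U"
    proof (intro equalityI subsetI)
      fix x assume x: "x \<in> C \<inter> (h \<circ> p) -` (h ` U)"
      then obtain w where "w \<in> U" "h (p x) = h w" by auto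
      moreover have "p x \<in> S" using x pC by auto
      ultimately have "p x = w" using kh US by (metis subsetD)
      then show "x \<in> C \<inter> p -` U" using x \<open>w \<in> U\<close> by auto
    qed auto
    moreover have "homeomorphism U (h ` U) h k"
      using homeomorphism_of_subsets[OF hom US, of "h ` U"] by (auto simp: hS[symmetric] US image_mono)
    ultimately show ?thesis
      using v by (metis homeomorphism_compose)
  qed
qed

lemma holomorphic_to_cp1_compose:
  assumes "holomorphic_to_cp1 f S" "h holomorphic_on T" "h \<in> T \<rightarrow> S"
  shows "holomorphic_to_cp1 (f \<circ> h) T"
proof -
  have "continuous_on T (f \<circ> h)"
    using assms by (intro continuous_on_compose holomorphic_on_imp_continuous_on)
      (auto simp: holomorphic_to_cp1_def intro: continuous_on_subset)
  moreover have "((\<lambda>z. coord0 (f z)) \<circ> h) holomorphic_on {z \<in> T. f (h z) \<noteq> Infty}"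
    using assms by (intro holomorphic_on_compose_gen[where t = "{z \<in> S. f z \<noteq> Infty}"])
      (auto simp: holomorphic_to_cp1_def elim: holomorphic_on_subset)
  moreover have "((\<lambda>z. coord1 (f z)) \<circ> h) holomorphic_on {z \<in> T. f (h z) \<noteq> Fin 0}"
    using assms by (intro holomorphic_on_compose_gen[where t = "{z \<in> S. f z \<noteq> Fin 0}"])
      (auto simp: holomorphic_to_cp1_def elim: holomorphic_on_subset)
  ultimately show ?thesis
    by (simp add: holomorphic_to_cp1_def o_def)
qed

lemma holomorphic_to_cp1_coord1:
  assumes "holomorphic_to_cp1 f S" "Fin 0 \<notin> f ` S"
  shows "(coord1 \<circ> f) holomorphic_on S"
proof -
  have "{z \<in> S. f z \<noteq> Fin 0} = S" using assms(2) by force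
  then show ?thesis using assms(1) by (simp add: holomorphic_to_cp1_def o_def)
qed

text \<open>
  Locally a lift is a local inverse of \<open>\<phi>\<close> after \<open>\<phi> \<circ> G\<close>. A covering map is locally injective, and
  injective holomorphic functions have holomorphic inverses.
\<close>

lemma holomorphic_lift:
  assumes cov: "covering_space C \<phi> S" and holo: "\<phi> holomorphic_on C" and C: "open C"
    and U: "open U" and contG: "continuous_on U G" and GU: "G \<in> U \<rightarrow> C"
    and comp: "(\<phi> \<circ> G) holomorphic_on U"
  shows "G holomorphic_on U"
proof -
  have "\<exists>W. open W \<and> z \<in> W \<and> G holomorphic_on W" if z: "z \<in> U" for z
  proof -
    have "G z \<in> C" using z GU by auto
    then obtain T u q where T: "G z \<in> T" "openin (top_of_set C) T" "homeomorphism T u \<phi> q"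
      using covering_space_local_homeomorphism[OF cov] by metis
    have "open T" "T \<subseteq> C" using T(2) C by (auto simp: openin_open_eq)
    have "inj_on \<phi> T" using T(3) by (metis homeomorphism_apply1 inj_onI)
    moreover have "\<phi> holomorphic_on T"
      using holo \<open>T \<subseteq> C\<close> by (rule holomorphic_on_subset)
    ultimately obtain g where g: "g holomorphic_on \<phi> ` T" "\<And>w. w \<in> T \<Longrightarrow> g (\<phi> w) = w"
      using holomorphic_has_inverse[OF _ \<open>open T\<close>] by metis
    define W where "W = U \<inter> G -` T"
    have "open W"
      unfolding W_def using contG \<open>open T\<close> U by (intro continuous_open_preimage)
    moreover have "z \<in> W" using z T(1) by (simp add: W_def)
    moreover have "(g \<circ> (\<phi> \<circ> G)) holomorphic_on W"
      using holomorphic_on_subset[OF comp, of W] g(1)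
      by (rule holomorphic_on_compose_gen) (auto simp: W_def)
    then have "G holomorphic_on W"
      by (rule holomorphic_transform) (auto simp: W_def g(2))
    ultimately show ?thesis by blast
  qed
  then show ?thesis
    using U by (metis holomorphic_on_open holomorphic_on_imp_differentiable_at
        field_differentiable_def)
qed

text \<open>
  The Schwarz lemma after the Cayley transform \<open>z \<mapsto> (z - \<tau>) / (z - \<tau>\<^sup>*)\<close>, which maps the half
  plane to the disc and \<open>\<tau>\<close> to \<open>0\<close>; here \<open>\<tau>\<^sup>*\<close> is the complex conjugate of \<open>\<tau>\<close>.
\<close>

lemma Schwarz_Pick_upper_half_plane:
  assumes holo: "G holomorphic_on ball 0 1" and im: "\<And>z. norm z < 1 \<Longrightarrow> Im (G z) > 0"
  shows "norm (deriv G 0) \<le> 2 * Im (G 0)"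
proof -
  define \<tau> where "\<tau> = G 0"
  have \<tau>: "Im \<tau> > 0" unfolding \<tau>_def by (rule im) simp
  have nz: "z - cnj \<tau> \<noteq> 0" if "Im z > 0" for z
    using that \<tau> by (auto simp: complex_eq_iff)
  define h where "h = (\<lambda>z. (G z - \<tau>) / (G z - cnj \<tau>))"
  have "h holomorphic_on ball 0 1"
    unfolding h_def using holo by (intro holomorphic_intros) (auto intro!: nz im simp del: right_minus_eq)
  moreover have "h 0 = 0" by (simp add: h_def \<tau>_def)
  moreover have "norm (h z) < 1" if "norm z < 1" for z
  proof -
    have "(norm (G z - \<tau>))\<^sup>2 < (norm (G z - cnj \<tau>))\<^sup>2"
      using im[OF that] \<tau> by (simp only: cmod_power2) (simp add: power2_eq_square algebra_simps)
    then have "norm (G z - \<tau>) < norm (G z - cnj \<tau>)"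
      by (rule power_less_imp_less_base) simp
    moreover have "norm (G z - cnj \<tau>) > 0"
      using nz[OF im[OF that]] by simp
    ultimately show ?thesis by (simp add: h_def norm_divide)
  qed
  ultimately have "norm (deriv h 0) \<le> 1"
    by (intro Schwarz_Lemma(2)[where \<xi> = 0]) auto
  moreover have "(h has_field_derivative deriv G 0 / (\<tau> - cnj \<tau>)) (at 0)"
  proof -
    have "(G has_field_derivative deriv G 0) (at 0)"
      using holo by (intro holomorphic_derivI[where S = "ball 0 1"]) auto
    then have "((\<lambda>z. G z - w) has_field_derivative deriv G 0) (at 0)" for w
      by (auto intro!: derivative_eq_intros)
    from DERIV_divide[OF this this, of "cnj \<tau>" \<tau>] show ?thesis
      using nz[OF \<tau>] by (simp add: h_def flip: \<tau>_def)
  qed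
  then have "deriv h 0 = deriv G 0 / (\<tau> - cnj \<tau>)" by (rule DERIV_imp_deriv)
  moreover have "norm (\<tau> - cnj \<tau>) = 2 * Im \<tau>"
    using \<tau> by (simp add: complex_diff_cnj norm_mult)
  ultimately show ?thesis
    using \<tau> by (simp add: norm_divide \<tau>_def[symmetric] field_simps)
qed

text \<open>
  Extremal discs for the Schwarz--Pick inequality: the inverse Cayley transform after a
  rotation, which gives the derivative any prescribed argument.
\<close>

lemma disc_to_upper_half_plane:
  assumes \<tau>: "Im \<tau> > 0" and u: "norm u = 1"
  obtains m where "m holomorphic_on ball 0 1" "m \<in> ball 0 1 \<rightarrow> upper_half_plane" "m 0 = \<tau>"
    "(m has_field_derivative 2 * of_real (Im \<tau>) * u) (at 0)"
proof
  \<comment> \<open>the inverse Cayley transform has derivative \<open>\<tau> - \<tau>\<^sup>* = 2 \<i> Im \<tau>\<close> at \<open>0\<close>; the factor \<open>-\<i>\<close> removes the \<open>\<i>\<close>\<close>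
  define e where "e = - \<i> * u"
  have e: "norm e = 1" using u by (simp add: e_def norm_mult)
  define m where "m = (\<lambda>z. (\<tau> - cnj \<tau> * (e * z)) / (1 - e * z))"
  have nz: "1 - e * z \<noteq> 0" if "norm z < 1" for z
  proof
    assume "1 - e * z = 0"
    then have "norm (e * z) = norm (1::complex)" by simp
    then show False using that e by (simp add: norm_mult)
  qed
  show "m holomorphic_on ball 0 1"
    unfolding m_def by (intro holomorphic_intros) (use nz in force)
  show "m 0 = \<tau>" by (simp add: m_def)
  have "\<tau> - cnj \<tau> = 2 * \<i> * of_real (Im \<tau>)"
    by (simp add: complex_diff_cnj)
  then have "(\<tau> - cnj \<tau>) * e = 2 * of_real (Im \<tau>) * u"
    by (simp add: e_def)
  moreover have "(m has_field_derivative (\<tau> - cnj \<tau>) * e) (at 0)"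
    unfolding m_def by (auto intro!: derivative_eq_intros simp: algebra_simps)
  ultimately show "(m has_field_derivative 2 * of_real (Im \<tau>) * u) (at 0)"
    by simp
  show "m \<in> ball 0 1 \<rightarrow> upper_half_plane"
  proof
    fix z :: complex assume "z \<in> ball 0 1"
    then have z: "norm z < 1" by simp
    define w where "w = e * z"
    have w: "norm w < 1" using z e by (simp add: w_def norm_mult)
    have "Im (m z) = Im ((\<tau> - cnj \<tau> * w) * cnj (1 - w)) / (norm (1 - w))\<^sup>2"
      by (simp add: m_def w_def[symmetric] complex_div_cnj[of _ "1 - w"]
          Im_divide_of_real del: complex_cnj_diff flip: of_real_power)
    also have "Im ((\<tau> - cnj \<tau> * w) * cnj (1 - w)) = Im \<tau> * (1 - (norm w)\<^sup>2)"
      by (simp only: cmod_power2) (simp add: power2_eq_square algebra_simps)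
    also have "Im \<tau> * (1 - (norm w)\<^sup>2) / (norm (1 - w))\<^sup>2 > 0"
      using \<tau> w nz[OF z] by (auto simp: w_def intro!: divide_pos_pos mult_pos_pos
          simp: abs_square_less_1)
    finally show "m z \<in> upper_half_plane" by (simp add: upper_half_plane_def)
  qed
qed

text \<open>
  The covering map is an isometry for the Kobayashi--Royden metric: every disc in \<open>N\<close> through
  \<open>f \<tau>\<close> lifts to a disc in the half plane through \<open>\<tau>\<close>, and the discs in the half plane are governed
  by the Schwarz--Pick inequality.
\<close>

lemma kobayashi_royden_eq_covering:
  assumes covering: "holomorphic_universal_covering upper_half_plane f N"
    and N: "Fin 0 \<notin> N" and \<tau>: "Im \<tau> > 0" and p: "f \<tau> = Fin p"
    and D: "((\<lambda>z. coord0 (f z)) has_field_derivative D) (at \<tau>)" and "D \<noteq> 0"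
  shows "kobayashi_royden N p v = norm v / (2 * Im \<tau> * norm D)"
proof -
  define X where "X = {1 / \<alpha> | \<alpha>. \<alpha> > 0 \<and>
       (\<exists>g. holomorphic_to_cp1 g (ball 0 1) \<and> g ` ball 0 1 \<subseteq> N \<and> g 0 = Fin p \<and>
            ((\<lambda>z. coord0 (g z)) has_field_derivative of_real \<alpha> * v) (at 0))}"
  have cov: "covering_space upper_half_plane f N" and holf: "holomorphic_to_cp1 f upper_half_plane"
    using covering by (auto simp: holomorphic_universal_covering_def)
  have fim: "f ` upper_half_plane = N"
    using cov by (rule covering_space_imp_surjective)
  have pN: "Fin p \<in> N"
    using fim \<tau> p by (force simp: upper_half_plane_def)
  have "Inf X = norm v / (2 * Im \<tau> * norm D)"
  proof (cases "v = 0")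
    case True
    \<comment> \<open>constant discs admit every \<open>\<alpha> > 0\<close>\<close>
    have "X = {0<..}"
    proof (intro equalityI subsetI)
      fix y :: real assume y: "y \<in> {0<..}"
      have "holomorphic_to_cp1 (\<lambda>_. Fin p) (ball 0 1)"
        by (simp add: holomorphic_to_cp1_def)
      moreover have "((\<lambda>z. coord0 (Fin p)) has_field_derivative of_real (1 / y) * v) (at 0)"
        using True by simp
      ultimately show "y \<in> X"
        using y pN unfolding X_def
        by (intro CollectI exI[of _ "1 / y"]) (auto intro!: exI[of _ "\<lambda>_. Fin p"])
    qed (auto simp: X_def)
    then show ?thesis using True by simp
  next
    case False
    define \<alpha>0 where "\<alpha>0 = 2 * Im \<tau> * norm D / norm v"
    have "\<alpha>0 > 0" using False \<tau> \<open>D \<noteq> 0\<close> by (simp add: \<alpha>0_def)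
    have "1 / \<alpha>0 \<in> X"
    proof -
      \<comment> \<open>the rotation that makes the derivative of the disc a positive multiple of \<open>v\<close>\<close>
      define u where "u = of_real (norm D) * v / (of_real (norm v) * D)"
      have "norm u = 1"
        using False \<open>D \<noteq> 0\<close> by (simp add: u_def norm_mult norm_divide)
      then obtain m where m: "m holomorphic_on ball 0 1" "m \<in> ball 0 1 \<rightarrow> upper_half_plane"
        "m 0 = \<tau>" "(m has_field_derivative 2 * of_real (Im \<tau>) * u) (at 0)"
        using disc_to_upper_half_plane[OF \<tau>] by metis
      have "((\<lambda>z. coord0 ((f \<circ> m) z)) has_field_derivative D * (2 * of_real (Im \<tau>) * u)) (at 0)"
        using DERIV_chain2[of "\<lambda>z. coord0 (f z)" D m 0] D m(3,4) by simp
      moreover have "D * (2 * of_real (Im \<tau>) * u) = of_real \<alpha>0 * v"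
        using False \<open>D \<noteq> 0\<close> by (simp add: u_def \<alpha>0_def field_simps)
      moreover have "holomorphic_to_cp1 (f \<circ> m) (ball 0 1)"
        using holf m by (intro holomorphic_to_cp1_compose)
      moreover have "(f \<circ> m) ` ball 0 1 \<subseteq> N"
        using m(2) fim by auto
      ultimately show ?thesis
        unfolding X_def using \<open>\<alpha>0 > 0\<close> m(3) p
        by (intro CollectI exI[of _ \<alpha>0]) (auto intro!: exI[of _ "f \<circ> m"])
    qed
    moreover have "1 / \<alpha>0 \<le> y" if yX: "y \<in> X" for y
    proof -
      obtain \<alpha> g where y: "y = 1 / \<alpha>" "\<alpha> > 0" and g: "holomorphic_to_cp1 g (ball 0 1)"
        "g ` ball 0 1 \<subseteq> N" "g 0 = Fin p"
        "((\<lambda>z. coord0 (g z)) has_field_derivative of_real \<alpha> * v) (at 0)"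
        using yX unfolding X_def by blast
      define \<phi> where "\<phi> = coord1 \<circ> f"
      define \<gamma> where "\<gamma> = coord1 \<circ> g"
      have hol\<phi>: "\<phi> holomorphic_on upper_half_plane"
        unfolding \<phi>_def using holf N fim by (intro holomorphic_to_cp1_coord1) auto
      have hol\<gamma>: "\<gamma> holomorphic_on ball 0 1"
        unfolding \<gamma>_def using g(1,2) N by (intro holomorphic_to_cp1_coord1) auto
      have "homeomorphism N (coord1 ` N) coord1 at_Infty"
        using homeomorphism_of_subsets[OF homeomorphism_coord1, of N "coord1 ` N"] N by auto
      then have cov\<phi>: "covering_space upper_half_plane \<phi> (coord1 ` N)"
        unfolding \<phi>_def by (rule covering_space_compose_homeomorphism[OF cov])
      have "simply_connected (ball 0 1 :: complex set)" "locally path_connected (ball 0 1 :: complex set)"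
        by (auto intro!: convex_imp_simply_connected convex_imp_locally_path_connected)
      moreover have "\<gamma> \<in> ball 0 1 \<rightarrow> coord1 ` N"
        using g(2) by (auto simp: \<gamma>_def)
      moreover have "\<gamma> 0 = \<phi> \<tau>" by (simp add: \<gamma>_def \<phi>_def g(3) p)
      moreover have "\<tau> \<in> upper_half_plane" using \<tau> by (simp add: upper_half_plane_def)
      ultimately obtain G where G: "continuous_on (ball 0 1) G" "G \<in> ball 0 1 \<rightarrow> upper_half_plane"
          "G 0 = \<tau>" "\<And>z. z \<in> ball 0 1 \<Longrightarrow> \<phi> (G z) = \<gamma> z"
        using covering_space_lift_strong[OF cov\<phi>, of \<tau> 0 "ball 0 1" \<gamma>]
          holomorphic_on_imp_continuous_on[OF hol\<gamma>] by auto
      have comp: "(\<phi> \<circ> G) holomorphic_on ball 0 1"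
        using hol\<gamma> by (rule holomorphic_transform) (simp add: G(4))
      have "open upper_half_plane"
        unfolding upper_half_plane_def by (rule open_halfspace_Im_gt)
      from holomorphic_lift[OF cov\<phi> hol\<phi> this open_ball G(1,2) comp]
      have holG: "G holomorphic_on ball 0 1" .
      have imG: "Im (G z) > 0" if "norm z < 1" for z
        using that G(2) by (auto simp: upper_half_plane_def Pi_iff)
      have "f (G z) = g z" if "z \<in> ball 0 1" for z
      proof -
        have "f (G z) \<noteq> Fin 0" "g z \<noteq> Fin 0"
          using that G(2) g(2) N fim by (metis Pi_iff image_eqI subsetD)+
        then show ?thesis
          using G(4)[OF that] by (metis \<phi>_def \<gamma>_def o_apply at_Infty_coord1)
      qed
      then have "\<forall>\<^sub>F z in nhds 0. coord0 (f (G z)) = coord0 (g z)"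
        by (intro eventually_nhds_in_open[of "ball 0 1", THEN eventually_mono]) auto
      moreover have "((\<lambda>z. coord0 (f (G z))) has_field_derivative D * deriv G 0) (at 0)"
        using DERIV_chain2[of "\<lambda>z. coord0 (f z)" D G 0] D G(3)
          holomorphic_derivI[OF holG, of 0] by simp
      ultimately have "((\<lambda>z. coord0 (g z)) has_field_derivative D * deriv G 0) (at 0)"
        using DERIV_cong_ev[OF refl _ refl] by metis
      then have "of_real \<alpha> * v = D * deriv G 0"
        using g(4) by (rule DERIV_unique[rotated])
      then have "\<alpha> * norm v = norm D * norm (deriv G 0)"
        using y(2) by (metis norm_mult norm_of_real abs_of_pos)
      also have "\<dots> \<le> norm D * (2 * Im \<tau>)"
        using Schwarz_Pick_upper_half_plane[OF holG imG] G(3)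
        by (intro mult_left_mono) auto
      finally have "\<alpha> \<le> \<alpha>0"
        using False by (simp add: \<alpha>0_def field_simps)
      then show ?thesis
        using y \<open>\<alpha>0 > 0\<close> by (simp add: frac_le)
    qed
    ultimately have "Inf X = 1 / \<alpha>0" by (rule cInf_eq_minimum)
    then show ?thesis by (simp add: \<alpha>0_def)
  qed
  then show ?thesis by (simp add: kobayashi_royden_def X_def)
qed

section \<open>The coordinate at the cusp\<close>

lemma open_Fin_image_ball: "open (Fin ` ball 0 e)"
proof -
  have "at_Infty -` (Fin ` ball 0 e) = {w. 1 < e * norm w}"
  proof (intro set_eqI iffI)
    fix w assume "w \<in> at_Infty -` (Fin ` ball 0 e)"
    then show "w \<in> {w. 1 < e * norm w}"
      by (auto simp: at_Infty_def norm_divide field_simps split: if_splits)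
  next
    fix w :: complex assume "w \<in> {w. 1 < e * norm w}"
    then have "w \<noteq> 0" "norm (1 / w) < e"
      by (cases "w = 0"; simp add: norm_divide field_simps)+
    then show "w \<in> at_Infty -` (Fin ` ball 0 e)"
      by (auto simp: at_Infty_def)
  qed
  moreover have "open {w::complex. 1 < e * norm w}"
    by (intro open_Collect_less continuous_intros)
  moreover have "Fin -` (Fin ` ball 0 e) = ball 0 e" by auto
  ultimately show ?thesis by (simp add: open_cp1_def)
qed

text \<open>
  A branch of the inverse of \<open>q\<close>. The height of the preimage only depends on \<open>\<bar>w\<bar>\<close>.
\<close>

lemma exp_preimage:
  assumes "w \<noteq> 0" "\<kappa> \<noteq> 0"
  shows "\<exists>\<tau>. exp (2 * of_real pi * \<i> * \<tau> / of_real \<kappa>) = w \<and>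
    Im \<tau> = - \<kappa> / (2 * pi) * ln (norm w)"
proof (intro exI conjI)
  let ?\<tau> = "of_real \<kappa> / (2 * of_real pi * \<i>) * Ln w"
  have "2 * of_real pi * \<i> * ?\<tau> / of_real \<kappa> = Ln w"
    using assms by simp
  then show "exp (2 * of_real pi * \<i> * ?\<tau> / of_real \<kappa>) = w"
    using assms by simp
  have "?\<tau> = - (of_real (\<kappa> / (2 * pi)) * (\<i> * Ln w))"
    by (simp add: field_simps)
  then show "Im ?\<tau> = - \<kappa> / (2 * pi) * ln (norm w)"
    using assms by simp
qed

text \<open>
  The constant \<open>\<kappa>\<close> has to be positive. For \<open>\<kappa> = 0\<close> the function \<open>q\<close> is constant (division by \<open>0\<close>
  gives \<open>0\<close>), and for \<open>\<kappa> < 0\<close> the cusp corresponds to \<open>q = \<infinity>\<close>, so that the series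
  \<open>\<Sum> c\<^sub>m q\<^sup>m\<close> is an entire function that vanishes at infinity. In both cases the expansion would be
  identically \<open>0\<close> near the cusp, but \<open>f\<close> omits the value \<open>0\<close>. For \<open>\<kappa> > 0\<close> the neighbourhoods of the
  cusp are the sets \<open>\<bar>q\<bar> < r\<close>.
\<close>

lemma expansion_at_cusp:
  fixes f :: "complex \<Rightarrow> cp1" and q :: "complex \<Rightarrow> complex" and c :: "complex fps"
  assumes avoids: "\<And>\<tau>. Im \<tau> > 0 \<Longrightarrow> f \<tau> \<noteq> Fin 0"
    and cusp: "(f \<longlongrightarrow> Fin 0) (filtercomap Im at_top)"
    and q: "\<And>\<tau>. q \<tau> = exp (2 * of_real pi * \<i> * \<tau> / of_real \<kappa>)"
    and expansion: "\<forall>\<^sub>F \<tau> in filtercomap Im at_top.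
          \<exists>z. f \<tau> = Fin z \<and> (\<lambda>m. c $ m * q \<tau> ^ m) sums z"
  obtains r where "\<kappa> > 0" "0 < r" "r \<le> 1" "fps_conv_radius c > 0"
    "\<And>\<tau>. norm (q \<tau>) < r \<Longrightarrow> f \<tau> = Fin (eval_fps c (q \<tau>))"
proof -
  obtain B where B: "\<And>\<tau>. Im \<tau> \<ge> B \<Longrightarrow> f \<tau> = Fin (eval_fps c (q \<tau>)) \<and> summable (\<lambda>m. c $ m * q \<tau> ^ m)"
    using expansion unfolding eventually_filtercomap eventually_at_top_linorder eval_fps_def sums_iff
    by metis
  have norm_q: "norm (q \<tau>) = exp (- 2 * pi * Im \<tau> / \<kappa>)" for \<tau>
    by (simp add: q Im_divide_of_real)
  have small: "\<exists>b. \<forall>\<tau>. Im \<tau> \<ge> b \<longrightarrow> norm (eval_fps c (q \<tau>)) < e" if "e > 0" for e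
  proof -
    have "\<forall>\<^sub>F \<tau> in filtercomap Im at_top. f \<tau> \<in> Fin ` ball 0 e"
      using that by (intro topological_tendstoD[OF cusp] open_Fin_image_ball) auto
    then obtain b where "\<And>\<tau>. Im \<tau> \<ge> b \<Longrightarrow> f \<tau> \<in> Fin ` ball 0 e"
      unfolding eventually_filtercomap eventually_at_top_linorder by metis
    then have "norm (eval_fps c (q \<tau>)) < e" if "Im \<tau> \<ge> max b B" for \<tau>
      using that B[of \<tau>] by force
    then show ?thesis by blast
  qed
  have nonzero: "eval_fps c (q \<tau>) \<noteq> 0" if "Im \<tau> \<ge> B" "Im \<tau> > 0" for \<tau>
    using B[of \<tau>] avoids[of \<tau>] that by auto
  have "\<kappa> > 0"
  proof (rule ccontr)
    assume "\<not> \<kappa> > 0"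
    then consider "\<kappa> = 0" | "\<kappa> < 0" by linarith
    then have "eval_fps c (q (\<i> * of_real (max B 1))) = 0"
    proof cases
      case 1
      have q1: "q \<tau> = 1" for \<tau> by (simp add: q 1)
      show ?thesis
      proof (rule ccontr)
        assume "\<not> ?thesis"
        then have "norm (eval_fps c 1) > 0" by (simp add: q1)
        then obtain b where "\<And>\<tau>. Im \<tau> \<ge> b \<Longrightarrow> norm (eval_fps c 1) < norm (eval_fps c 1)"
          using small q1 by metis
        from this[of "\<i> * of_real b"] show False by simp
      qed
    next
      case 2
      have large: "\<exists>\<tau>. q \<tau> = w \<and> Im \<tau> \<ge> b" if "norm w \<ge> exp (- 2 * pi * b / \<kappa>)" for w b
      proof -
        have "w \<noteq> 0" using that by auto
        then obtain \<tau> where \<tau>: "q \<tau> = w" "Im \<tau> = - \<kappa> / (2 * pi) * ln (norm w)"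
          using exp_preimage[of w \<kappa>] 2 q by auto
        have "- 2 * pi * b / \<kappa> \<le> ln (norm w)"
          using that \<open>w \<noteq> 0\<close> by (simp add: ln_ge_iff)
        then have "Im \<tau> \<ge> b" using 2 unfolding \<tau>(2) by (simp add: field_simps)
        then show ?thesis using \<tau>(1) by blast
      qed
      have "fps_conv_radius c \<ge> ereal R" for R
      proof -
        define R' where "R' = max R (exp (- 2 * pi * B / \<kappa>))"
        define w :: complex where "w = of_real R'"
        have "R' > 0" by (simp add: R'_def less_max_iff_disj)
        then have w: "norm w = R'" by (simp add: w_def)
        have "norm w \<ge> exp (- 2 * pi * B / \<kappa>)" by (simp add: w R'_def)
        then obtain \<tau> where "q \<tau> = w" "Im \<tau> \<ge> B" using large[of B w] by auto
        then have "summable (\<lambda>m. c $ m * w ^ m)" using B by metis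
        then have "fps_conv_radius c \<ge> norm w"
          unfolding fps_conv_radius_def by (rule conv_radius_geI)
        then show ?thesis unfolding w by (rule order_trans[rotated]) (simp add: R'_def)
      qed
      then have "fps_conv_radius c = \<infinity>" by (rule ereal_top)
      then have "eval_fps c holomorphic_on UNIV"
        by (intro holomorphic_on_eval_fps) auto
      moreover have "(eval_fps c \<longlongrightarrow> 0) at_infinity"
      proof (rule tendstoI)
        fix e :: real assume "e > 0"
        then obtain b where "\<And>\<tau>. Im \<tau> \<ge> b \<Longrightarrow> norm (eval_fps c (q \<tau>)) < e" using small by blast
        then have "norm (eval_fps c w) < e" if "norm w \<ge> exp (- 2 * pi * b / \<kappa>)" for w
          using large[OF that] by blast
        then show "\<forall>\<^sub>F w in at_infinity. dist (eval_fps c w) 0 < e"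
          unfolding eventually_at_infinity by auto
      qed
      ultimately show ?thesis by (rule Liouville_weak)
    qed
    then show False using nonzero[of "\<i> * of_real (max B 1)"] by simp
  qed
  \<comment> \<open>\<open>\<bar>q \<tau>\<bar>\<close> is below the exponential exactly when \<open>Im \<tau> > B\<close>, and \<open>r \<le> 1\<close> keeps \<open>\<tau>\<close> in the half plane\<close>
  define r where "r = min 1 (exp (- 2 * pi * B / \<kappa>))"
  show ?thesis
  proof
    show "\<kappa> > 0" by fact
    show "0 < r" "r \<le> 1" by (auto simp: r_def)
    show "f \<tau> = Fin (eval_fps c (q \<tau>))" if "norm (q \<tau>) < r" for \<tau>
    proof -
      have "- 2 * pi * Im \<tau> / \<kappa> < - 2 * pi * B / \<kappa>"
        using that by (simp add: norm_q r_def)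
      then have "Im \<tau> \<ge> B" using \<open>\<kappa> > 0\<close> by (simp add: field_simps)
      then show ?thesis using B by blast
    qed
    have "summable (\<lambda>m. c $ m * q (\<i> * of_real B) ^ m)" using B[of "\<i> * of_real B"] by simp
    then have "fps_conv_radius c \<ge> norm (q (\<i> * of_real B))"
      unfolding fps_conv_radius_def by (rule conv_radius_geI)
    moreover have "0 < ereal (norm (q (\<i> * of_real B)))" by (simp add: norm_q)
    ultimately show "fps_conv_radius c > 0" by (rule less_le_trans[rotated])
  qed
qed

text \<open>
  The compositional inverse of a convergent series converges: by the inverse function theorem
  the sum of \<open>c\<close> has a holomorphic local inverse, and its Taylor series is a left
  compositional inverse of \<open>c\<close> too, hence equal to \<open>b\<close>.
\<close>

lemma fps_inverse_function:
  fixes b c :: "complex fps"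
  assumes c: "fps_conv_radius c > 0" "c $ 0 = 0" and b: "b $ 0 = 0" "b oo c = fps_X"
  shows "b $ 1 \<noteq> 0" "fps_conv_radius b > 0" "c oo b = fps_X"
proof -
  have "(b oo c) $ 1 = b $ 1 * c $ 1"
    by (simp add: fps_compose_nth)
  then have b1c1: "b $ 1 * c $ 1 = 1" using b(2) by simp
  then show "b $ 1 \<noteq> 0" by auto
  have c1: "c $ 1 \<noteq> 0" using b1c1 by auto
  have "b = fps_inv c"
    using fps_compose_inj_right[OF c(2) c1] fps_inv[OF c(2) c1] b(2) by metis
  then show "c oo b = fps_X"
    using fps_inv_right[OF c(2) c1] by simp
  define F where "F = eval_fps c"
  have F: "F has_fps_expansion c"
    unfolding F_def using c(1) by (rule eval_fps_has_fps_expansion)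
  have holF: "F holomorphic_on eball 0 (fps_conv_radius c)"
    unfolding F_def by (rule holomorphic_on_eval_fps) simp
  have zero_in: "(0 :: complex) \<in> eball 0 (fps_conv_radius c)"
    using c(1) by (simp add: zero_ereal_def)
  have "c $ 1 = deriv F 0"
    using fps_nth_fps_expansion[OF F, of 1] by simp
  with c1 have "deriv F 0 \<noteq> 0" by simp
  then obtain r where r: "r > 0" "ball (0 :: complex) r \<subseteq> eball 0 (fps_conv_radius c)" "open (F ` ball 0 r)"
      "inj_on F (ball 0 r)"
    by (rule has_complex_derivative_locally_invertible[OF holF zero_in open_eball])
  have "F holomorphic_on ball 0 r" using holF r(2) by (rule holomorphic_on_subset)
  then obtain g where g: "g holomorphic_on F ` ball 0 r" "\<And>z. z \<in> ball 0 r \<Longrightarrow> g (F z) = z"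
    using holomorphic_has_inverse r(4) by (metis open_ball)
  have "F 0 = 0" by (simp add: F_def eval_fps_at_0 c(2))
  then have "0 \<in> F ` ball 0 r" using r(1) by (metis centre_in_ball image_eqI)
  then have G: "g has_fps_expansion fps_expansion g 0"
    using r(3) g(1) by blast
  have "(g \<circ> F) has_fps_expansion (fps_expansion g 0 oo c)"
    using G F c(2) by (rule has_fps_expansion_compose)
  moreover have "\<forall>\<^sub>F z in nhds 0. (g \<circ> F) z = z"
    using r(1) by (intro eventually_nhds_in_open[of "ball 0 r", THEN eventually_mono]) (auto simp: g(2))
  then have "(g \<circ> F) has_fps_expansion fps_X \<longleftrightarrow> (\<lambda>z. z) has_fps_expansion (fps_X :: complex fps)"
    by (rule has_fps_expansion_cong) simp
  then have "(g \<circ> F) has_fps_expansion fps_X"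
    by (simp add: has_fps_expansion_fps_X)
  ultimately have "fps_expansion g 0 oo c = fps_X"
    by (rule fps_expansion_unique_complex)
  then have "b = fps_expansion g 0"
    using fps_compose_inj_right[OF c(2) c1] b(2) by metis
  then show "fps_conv_radius b > 0"
    using G by (simp add: has_fps_expansion_def)
qed

section \<open>The asymptotic expansion of the metric\<close>

text \<open>
  The metric in terms of the local inverse \<open>Q\<close> of \<open>q \<mapsto> \<Sum> c\<^sub>m q\<^sup>m\<close>. With \<open>q(\<tau>) = Q(p)\<close>, the chain
  rule gives \<open>f'(\<tau>) = (2\<pi>\<i> / \<kappa>) Q(p) / Q'(p)\<close>, and the factor \<open>2\<pi> / \<kappa>\<close> cancels
  against \<open>Im \<tau> = - \<kappa> log \<bar>Q(p)\<bar> / (2\<pi>)\<close>.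
\<close>

lemma kobayashi_royden_near_cusp:
  fixes f :: "complex \<Rightarrow> cp1" and b c :: "complex fps"
  defines "Q \<equiv> eval_fps b"
  assumes covering: "holomorphic_universal_covering upper_half_plane f N" and N: "Fin 0 \<notin> N"
    and "\<kappa> > 0" and r: "0 < r" "r \<le> 1"
    and f: "\<And>\<tau>. norm (exp (2 * of_real pi * \<i> * \<tau> / of_real \<kappa>)) < r \<Longrightarrow>
      f \<tau> = Fin (eval_fps c (exp (2 * of_real pi * \<i> * \<tau> / of_real \<kappa>)))"
    and c: "fps_conv_radius c > 0" "c $ 0 = 0"
    and b: "b $ 0 = 0" "b oo c = fps_X"
  shows "\<forall>\<^sub>F p in at 0. \<forall>v. kobayashi_royden N p v =
    norm v * norm (eval_fps (fps_deriv b) p) / (2 * norm (Q p) * \<bar>ln (norm (Q p))\<bar>)"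
proof -
  let ?q = "\<lambda>\<tau>. exp (2 * of_real pi * \<i> * \<tau> / of_real \<kappa>)"
  let ?F = "eval_fps c"
  note b_inv = fps_inverse_function[OF c b]
  have Q: "Q has_fps_expansion b" and F: "?F has_fps_expansion c"
    unfolding Q_def using b_inv(2) c(1) by (auto intro: eval_fps_has_fps_expansion)
  have "(?F \<circ> Q) has_fps_expansion (c oo b)"
    using F Q b(1) by (rule has_fps_expansion_compose)
  then have "\<forall>\<^sub>F w in nhds 0. ?F (Q w) = w"
    by (simp add: b_inv(3) has_fps_expansion_def eq_commute)
  then have "\<forall>\<^sub>F p in nhds 0. \<forall>\<^sub>F w in nhds p. ?F (Q w) = w"
    by (simp add: eventually_eventually)
  then have FQ: "\<forall>\<^sub>F p in at 0. \<forall>\<^sub>F w in nhds p. ?F (Q w) = w"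
    by (simp add: eventually_nhds_conv_at)
  have "Q \<midarrow>0\<rightarrow> Q 0"
    using has_fps_expansion_imp_continuous[OF Q] by (simp add: continuous_within)
  moreover have "Q 0 = 0" by (simp add: Q_def eval_fps_at_0 b(1))
  ultimately have "\<forall>\<^sub>F p in at 0. Q p \<in> ball 0 r \<inter> eball 0 (fps_conv_radius c)"
    using r c(1) by (intro topological_tendstoD open_Int) (auto simp: zero_ereal_def)
  moreover have "\<forall>\<^sub>F p in nhds (0 :: complex). p \<in> eball 0 (fps_conv_radius b)"
    using b_inv(2) by (intro eventually_nhds_in_open) (auto simp: zero_ereal_def)
  then have "\<forall>\<^sub>F p in at (0 :: complex). p \<in> eball 0 (fps_conv_radius b)"
    by (simp add: eventually_nhds_conv_at)
  moreover have "\<forall>\<^sub>F p in at 0. p \<noteq> (0 :: complex)" by (rule eventually_neq_at_within)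
  ultimately show ?thesis
    using FQ
  proof eventually_elim
    case (elim p)
    define F' where "F' = eval_fps (fps_deriv c) (Q p)"
    define Q' where "Q' = eval_fps (fps_deriv b) p"
    have FQp: "?F (Q p) = p" using eventually_nhds_x_imp_x[OF elim(4)] .
    have dF: "(?F has_field_derivative F') (at (Q p))"
      unfolding F'_def using elim(1) by (intro has_field_derivative_eval_fps) simp
    have dQ: "(Q has_field_derivative Q') (at p)"
      unfolding Q_def Q'_def using elim(2) by (intro has_field_derivative_eval_fps) simp
    have "((\<lambda>w. ?F (Q w)) has_field_derivative F' * Q') (at p)"
      by (rule DERIV_chain2[OF dF dQ])
    moreover have "((\<lambda>w. ?F (Q w)) has_field_derivative 1) (at p)"
      using DERIV_cong_ev[OF refl elim(4) refl] DERIV_ident by blast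
    ultimately have FQ': "F' * Q' = 1" by (rule DERIV_unique)
    have "Q p \<noteq> 0"
    proof
      assume "Q p = 0"
      then show False using FQp elim(3) by (simp add: eval_fps_at_0 c(2))
    qed
    then obtain \<tau> where \<tau>: "?q \<tau> = Q p" "Im \<tau> = - \<kappa> / (2 * pi) * ln (norm (Q p))"
      using exp_preimage[of "Q p" \<kappa>] \<open>\<kappa> > 0\<close> by auto
    have Qr: "norm (Q p) < r" using elim(1) by simp
    then have ln_neg: "ln (norm (Q p)) < 0"
      using \<open>Q p \<noteq> 0\<close> r(2) by simp
    then have Im_pos: "Im \<tau> > 0" 
      using \<open>\<kappa> > 0\<close> unfolding \<tau>(2) by (simp add: mult_pos_neg divide_neg_pos)
    have f\<tau>: "f \<tau> = Fin p" using f[of \<tau>] Qr by (simp add: \<tau>(1) FQp)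
    define D where "D = F' * (Q p * (2 * of_real pi * \<i> / of_real \<kappa>))"
    have dq: "(?q has_field_derivative Q p * (2 * of_real pi * \<i> / of_real \<kappa>)) (at \<tau>)"
      unfolding \<tau>(1)[symmetric] using \<open>\<kappa> > 0\<close> by (auto intro!: derivative_eq_intros)
    have dFq: "((\<lambda>z. ?F (?q z)) has_field_derivative D) (at \<tau>)"
      unfolding D_def using dF dq \<tau>(1) by (intro DERIV_chain2[of ?F F' ?q]) simp_all
    have ev: "\<forall>\<^sub>F z in nhds \<tau>. coord0 (f z) = ?F (?q z)"
    proof -
      have "open {z. norm (?q z) < r}"
        using \<open>\<kappa> > 0\<close> by (intro open_Collect_less continuous_intros) auto
      then have "\<forall>\<^sub>F z in nhds \<tau>. z \<in> {z. norm (?q z) < r}"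
        using Qr by (intro eventually_nhds_in_open) (simp_all only: mem_Collect_eq \<tau>(1))
      then show ?thesis
        by eventually_elim (simp only: f mem_Collect_eq, simp add: coord0_def)
    qed
    have df: "((\<lambda>z. coord0 (f z)) has_field_derivative D) (at \<tau>)"
      using dFq by (subst DERIV_cong_ev[OF refl ev refl])
    have "D \<noteq> 0"
      using FQ' \<open>Q p \<noteq> 0\<close> \<open>\<kappa> > 0\<close> by (auto simp: D_def)
    then have KR: "kobayashi_royden N p v = norm v / (2 * Im \<tau> * norm D)" for v
      by (rule kobayashi_royden_eq_covering[OF covering N Im_pos f\<tau> df])
    have "norm F' * norm Q' = 1" using FQ' by (metis norm_mult norm_one)
    moreover from this have "norm Q' \<noteq> 0" by auto
    ultimately have "norm F' = 1 / norm Q'" by (simp add: field_simps)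
    moreover have "2 * Im \<tau> * norm D = 2 * \<bar>ln (norm (Q p))\<bar> * norm (Q p) * norm F'"
      using \<open>\<kappa> > 0\<close> ln_neg by (simp add: D_def norm_mult norm_divide \<tau>(2))
    ultimately show ?case
      by (simp add: KR Q'_def field_simps)
  qed
qed

theorem theorem1p1:
  fixes n :: nat and a :: "nat \<Rightarrow> cp1" and M :: "cp1 set"
    and f :: "complex \<Rightarrow> cp1" and \<kappa> :: real and q :: "complex \<Rightarrow> complex"
    and b c :: "complex fps"
  assumes n: "n \<ge> 3"
    and a_distinct: "inj_on a {1..n}"
    and a1: "a 1 = Fin 0"
    and M: "M = UNIV - a ` {1..n}"
    and covering: "holomorphic_universal_covering upper_half_plane f M"
    and cusp: "(f \<longlongrightarrow> Fin 0) (filtercomap Im at_top)"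
    and q: "\<And>\<tau>. q \<tau> = exp (2 * of_real pi * \<i> * \<tau> / of_real \<kappa>)"
    and c0: "c $ 0 = 0"
    and expansion: "\<forall>\<^sub>F \<tau> in filtercomap Im at_top.
          \<exists>z. f \<tau> = Fin z \<and> (\<lambda>m. c $ m * q \<tau> ^ m) sums z"
    and b0: "b $ 0 = 0"
    and inverse: "b oo c = fps_X"
  shows "\<forall>\<^sub>F p in at 0.
           summable (\<lambda>m. expansion_term b p (Suc m)) \<and>
           (\<forall>v. kobayashi_royden M p v =
                  1 / 2 * (1 / (norm p * \<bar>ln (norm (b $ 1 * p))\<bar>)
                    * norm (1 + (\<Sum>m. expansion_term b p (Suc m))) * norm v))"
proof -
  have "1 \<in> {1..n}" using n by simp
  then have M0: "Fin 0 \<notin> M" using a1 M by (metis Diff_iff image_eqI)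
  have "f ` upper_half_plane = M"
    using covering unfolding holomorphic_universal_covering_def
    by (blast dest: covering_space_imp_surjective)
  then have avoids: "f \<tau> \<noteq> Fin 0" if "Im \<tau> > 0" for \<tau>
    using M0 that by (force simp: upper_half_plane_def)
  obtain r where r: "\<kappa> > 0" "0 < r" "r \<le> 1" "fps_conv_radius c > 0"
    "\<And>\<tau>. norm (q \<tau>) < r \<Longrightarrow> f \<tau> = Fin (eval_fps c (q \<tau>))"
    using expansion_at_cusp[OF avoids cusp q expansion] by metis
  note inv = fps_inverse_function[OF r(4) c0 b0 inverse]
  have "\<forall>\<^sub>F p in at 0. \<forall>v. kobayashi_royden M p v = norm v * norm (eval_fps (fps_deriv b) p) /
      (2 * norm (eval_fps b p) * \<bar>ln (norm (eval_fps b p))\<bar>)"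
    using kobayashi_royden_near_cusp[OF covering M0 r(1-3) _ r(4) c0 b0 inverse] r(5) by (simp add: q)
  moreover have "\<forall>\<^sub>F p in at 0. eval_fps b p = b $ 1 * p * exp (eval_fps (log_series b) p)"
    using eventually_eval_fps_eq_exp_log_series[OF b0 inv(1,2)]
    by (simp add: eventually_nhds_conv_at)
  moreover have "\<forall>\<^sub>F p in at 0. p * eval_fps (fps_deriv b) p =
      eval_fps b p * (1 + p * eval_fps (fps_deriv (log_series b)) p)"
    using eventually_deriv_eq_log_series[OF b0 inv(1,2)]
    by (simp add: eventually_nhds_conv_at)
  moreover have "\<forall>\<^sub>F p in at 0. norm (b $ 1 * p) < 1"
    by (rule order_tendstoD(2)[of _ 0]) (auto intro!: tendsto_eq_intros)
  moreover have "\<forall>\<^sub>F p in at 0. p \<noteq> (0 :: complex)" by (rule eventually_neq_at_within)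
  ultimately show ?thesis
    using eventually_expansion_sum[OF inv(1,2)]
  proof eventually_elim
    case (elim p)
    define L where "L = ln (norm (b $ 1 * p))"
    define A where "A = eval_fps (log_series b) p"
    define A' where "A' = eval_fps (fps_deriv (log_series b)) p"
    define Q where "Q = eval_fps b p"
    define Q' where "Q' = eval_fps (fps_deriv b) p"
    have "L < 0" using elim(4,5) inv(1) by (simp add: L_def)
    have "Q = b $ 1 * p * exp A" using elim(2) by (simp add: Q_def A_def)
    then have "Q \<noteq> 0" and lnQ: "ln (norm Q) = L + Re A"
      using inv(1) elim(5) by (simp_all add: L_def norm_mult ln_mult)
    have "p * Q' = Q * (1 + p * A')" using elim(3) by (simp add: Q_def Q'_def A'_def)
    then have "1 + p * A' = p * Q' / Q" using \<open>Q \<noteq> 0\<close> by (simp add: field_simps)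
    moreover have "1 + Re A / L = ln (norm Q) / L" using \<open>L < 0\<close> by (simp add: lnQ field_simps)
    ultimately have "norm (1 + (\<Sum>m. expansion_term b p (Suc m))) =
        norm (p * Q' / Q / of_real (ln (norm Q) / L))"
      using elim(6) by (simp add: A_def A'_def L_def)
    also have "\<dots> = norm p * norm Q' * \<bar>L\<bar> / (norm Q * \<bar>ln (norm Q)\<bar>)"
      by (simp add: norm_mult norm_divide)
    finally have sum: "norm (1 + (\<Sum>m. expansion_term b p (Suc m))) =
        norm p * norm Q' * \<bar>L\<bar> / (norm Q * \<bar>ln (norm Q)\<bar>)" .
    have "kobayashi_royden M p v =
        1 / 2 * (1 / (norm p * \<bar>L\<bar>) * norm (1 + (\<Sum>m. expansion_term b p (Suc m))) * norm v)" for v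
      using elim(1,5) \<open>L < 0\<close> unfolding sum by (simp add: Q_def Q'_def mult_ac)
    then show ?case using elim(6) by (simp add: L_def)
  qed
qed

end
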